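(* Let $n\ge 1$ be an integer, let $m,d,k_1>0$ be fixed, and let $\boldsymbol L\in\mathbb{R}^{n\times n}$ be the (symmetric) Laplacian matrix of a connected undirected weighted graph on $n$ nodes with positive edge weights. For $k_3>0$ consider the closed-loop system of DPIAC \begin{align*} \dot{\boldsymbol\theta}&=\boldsymbol\omega,\\ m\,\dot{\boldsymbol\omega}&=-\boldsymbol L\boldsymbol\theta-d\,\boldsymbol\omega+4k_1\boldsymbol\xi+\boldsymbol w,\\ \dot{\boldsymbol\eta}&=d\,\boldsymbol\omega+4k_1k_3\boldsymbol L\boldsymbol\xi,\\ \dot{\boldsymbol\xi}&=-k_1m\,\boldsymbol\omega-k_1\boldsymbol\eta-4k_1\boldsymbol\xi, \end{align*} with state in $(\mathbb{R}^n)^4$, input $\boldsymbol w\in\mathbb{R}^n$ and control input $\boldsymbol u=4k_1\boldsymbol\xi$, and denote by $\|\boldsymbol G_d(\boldsymbol\omega,\boldsymbol w)\|_2^2$ and $\|\boldsymbol G_d(\boldsymbol u,\boldsymbol w)\|_2^2$ its squared $\mathcal{H}_2$ norms from $\boldsymbol w$ to $\boldsymbol\omega$ and to $\boldsymbol u$. Consider also the closed-loop system of GBPIAC \begin{align*} \dot{\boldsymbol\theta}&=\boldsymbol\omega,\\ m\,\dot{\boldsymbol\omega}&=-\boldsymbol L\boldsymbol\theta-d\,\boldsymbol\omega+\frac{4k_1\xi_s}{n}\boldsymbol 1_n+\boldsymbol w,\\ \dot\eta_s&=d\,\boldsymbol 1_n^T\boldsymbol\omega,\\ \dot\xi_s&=-k_1m\,\boldsymbol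 1_n^T\boldsymbol\omega-k_1\eta_s-4k_1\xi_s, \end{align*} with state in $\mathbb{R}^n\times\mathbb{R}^n\times\mathbb{R}\times\mathbb{R}$, input $\boldsymbol w\in\mathbb{R}^n$ and control input $\boldsymbol u=\frac{4k_1\xi_s}{n}\boldsymbol 1_n$, and denote by $\|\boldsymbol G_c(\boldsymbol\omega,\boldsymbol w)\|_2^2$ and $\|\boldsymbol G_c(\boldsymbol u,\boldsymbol w)\|_2^2$ its squared $\mathcal{H}_2$ norms from $\boldsymbol w$ to $\boldsymbol\omega$ and to $\boldsymbol u$. Then \begin{align*} \lim_{k_3\to\infty}\|\boldsymbol G_d(\boldsymbol\omega,\boldsymbol w)\|_2^2&=\frac{n-1}{2md}+\frac{d+5mk_1}{2m(2k_1m+d)^2}=\|\boldsymbol G_c(\boldsymbol\omega,\boldsymbol w)\|_2^2,\\ \lim_{k_3\to\infty}\|\boldsymbol G_d(\boldsymbol u,\boldsymbol w)\|_2^2&=\frac{k_1}{2}=\|\boldsymbol G_c(\boldsymbol u,\boldsymbol w)\|_2^2 . \end{align*}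
   Context: $\boldsymbol 1_n\in\mathbb{R}^n$ is the all-ones vector. DPIAC (Distributed Power-Imbalance Allocation Control) and GBPIAC (Gather-Broadcast Power-Imbalance Allocation Control) are, respectively, a distributed and a centralized secondary frequency control law for power systems; the systems in the claim are the linearized power system with homogeneous parameters (inertia $m$, damping $d$, control prices $1$) closed by these laws with gains $k_1$, $k_2=4k_1$ (and $k_3$ for DPIAC, whose communication network equals the power network, both with Laplacian $\boldsymbol L$). $\mathcal{H}_2$ norm: for a linear time-invariant system $\dot{\boldsymbol x}=\boldsymbol A\boldsymbol x+\tilde{\boldsymbol B}\boldsymbol w$, $\boldsymbol y=\boldsymbol C\boldsymbol x$, the squared $\mathcal{H}_2$ norm of the transfer matrix from $\boldsymbol w$ to $\boldsymbol y$ is $$\int_0^\infty \mathrm{tr}\big(\tilde{\boldsymbol B}^Te^{\boldsymbol A^Tt}\boldsymbol C^T\boldsymbol C e^{\boldsymbol At}\tilde{\boldsymbol B}\big)\,dt .$$ When $\boldsymbol A$ is Hurwitz this equals $\mathrm{tr}(\tilde{\boldsymbol B}^T\boldsymbol Q_o\tilde{\boldsymbol B})$, where $\boldsymbol Q_o$ solves $\boldsymbol Q_o\boldsymbol A+\boldsymbol A^T\boldsymbol Q_o+\boldsymbol C^T\boldsymbol C=\boldsymbol 0$. The systems are put in this form by stacking the states and dividing the second equation by $m$. *)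

theory Defs
  imports "HOL-Analysis.Analysis"
begin

section \<open>Weighted graphs and their Laplacian\<close>

text \<open>The weight function \<open>c\<close> is relevant on the edges only; an undirected edge
  is present in \<open>E\<close> in both orientations.\<close>

definition connected_weighted_graph :: "('n::finite \<times> 'n) set \<Rightarrow> ('n \<Rightarrow> 'n \<Rightarrow> real) \<Rightarrow> bool" where
  "connected_weighted_graph E c \<longleftrightarrow>
     sym E \<and> irrefl E \<and>
     (\<forall>(i, j) \<in> E. c i j > 0 \<and> c i j = c j i) \<and>
     (\<forall>i j. (i, j) \<in> E\<^sup>*)"

definition laplacian :: "('n::finite \<times> 'n) set \<Rightarrow> ('n \<Rightarrow> 'n \<Rightarrow> real) \<Rightarrow> real^'n^'n" where
  "laplacian E c =
     (\<chi> i j. if i = j then (\<Sum>k | (i, k) \<in> E. c i k)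
            else if (i, j) \<in> E then - c i j else 0)"


section \<open>The squared H2 norm of a linear time-invariant system\<close>

text \<open>The library has no exponential on \<open>real^'s^'s\<close>: there \<open>*\<close> is the componentwise
  product, so the generic \<open>exp\<close> and \<open>^\<close> are of no use.\<close>

definition mat_pow :: "real^'s^'s \<Rightarrow> nat \<Rightarrow> real^'s^'s" where
  "mat_pow A k = (((**) A) ^^ k) (mat 1)"

definition mat_exp :: "real^'s^'s \<Rightarrow> real^'s^'s" where
  "mat_exp A = (\<Sum>k. (1 / fact k) *\<^sub>R mat_pow A k)"

text \<open>The integrand is nonnegative, being the trace of \<open>M\<^sup>T M\<close> with \<open>M = C exp(t A) B\<close>. The integral
  is taken in \<open>[0,\<infinity>]\<close>, so that the norm is infinite exactly when the integral diverges; no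
  stability of \<open>A\<close> is presupposed.\<close>

definition h2_norm_sq :: "real^'s^'s \<Rightarrow> real^'i^'s \<Rightarrow> real^'s^'o \<Rightarrow> ennreal" where
  "h2_norm_sq A B C =
     (\<integral>\<^sup>+ t \<in> {0..}.
        ennreal (trace (transpose B ** mat_exp (t *\<^sub>R transpose A) ** transpose C
                        ** C ** mat_exp (t *\<^sub>R A) ** B)) \<partial>lborel)"


section \<open>State vectors stacked from four blocks\<close>

definition stack4 ::
  "real^'a \<Rightarrow> real^'b \<Rightarrow> real^'c \<Rightarrow> real^'d \<Rightarrow> real^('a::finite + 'b::finite + 'c::finite + 'd::finite)" where
  "stack4 p q r s =
     (\<chi> i. case i of Inl a \<Rightarrow> p $ a
                   | Inr (Inl b) \<Rightarrow> q $ b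
                   | Inr (Inr (Inl c)) \<Rightarrow> r $ c
                   | Inr (Inr (Inr d)) \<Rightarrow> s $ d)"

definition block1 :: "real^('a::finite + 'b::finite + 'c::finite + 'd::finite) \<Rightarrow> real^'a" where
  "block1 x = (\<chi> i. x $ Inl i)"

definition block2 :: "real^('a::finite + 'b::finite + 'c::finite + 'd::finite) \<Rightarrow> real^'b" where
  "block2 x = (\<chi> i. x $ Inr (Inl i))"

definition block3 :: "real^('a::finite + 'b::finite + 'c::finite + 'd::finite) \<Rightarrow> real^'c" where
  "block3 x = (\<chi> i. x $ Inr (Inr (Inl i)))"

definition block4 :: "real^('a::finite + 'b::finite + 'c::finite + 'd::finite) \<Rightarrow> real^'d" where
  "block4 x = (\<chi> i. x $ Inr (Inr (Inr i)))"

lemmas stack_defs = stack4_def block1_def block2_def block3_def block4_def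


section \<open>DPIAC\<close>

text \<open>The state is \<open>(\<theta>, \<omega>, \<eta>, \<xi>)\<close>. The right-hand side of the differential equation is jointly
  linear in state \<open>x\<close> and input \<open>w\<close>, and the system matrices are read off from it.\<close>

definition dpiac_rhs ::
  "real^'n::finite^'n \<Rightarrow> real \<Rightarrow> real \<Rightarrow> real \<Rightarrow> real \<Rightarrow>
   real^('n + 'n + 'n + 'n) \<Rightarrow> real^'n \<Rightarrow> real^('n + 'n + 'n + 'n)" where
  "dpiac_rhs L m d k1 k3 x w =
     (let \<theta> = block1 x; \<omega> = block2 x; \<eta> = block3 x; \<xi> = block4 x in
      stack4
        \<omega>
        ((1 / m) *\<^sub>R (- (L *v \<theta>) - d *\<^sub>R \<omega> + (4 * k1) *\<^sub>R \<xi> + w))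
        (d *\<^sub>R \<omega> + (4 * k1 * k3) *\<^sub>R (L *v \<xi>))
        (- ((k1 * m) *\<^sub>R \<omega>) - k1 *\<^sub>R \<eta> - (4 * k1) *\<^sub>R \<xi>))"

definition dpiac_omega :: "real^('n::finite + 'n + 'n + 'n) \<Rightarrow> real^'n" where
  "dpiac_omega x = block2 x"

definition dpiac_u :: "real \<Rightarrow> real^('n::finite + 'n + 'n + 'n) \<Rightarrow> real^'n" where
  "dpiac_u k1 x = (4 * k1) *\<^sub>R block4 x"

definition dpiac_A ::
  "real^'n::finite^'n \<Rightarrow> real \<Rightarrow> real \<Rightarrow> real \<Rightarrow> real \<Rightarrow> real^('n + 'n + 'n + 'n)^('n + 'n + 'n + 'n)" where
  "dpiac_A L m d k1 k3 = matrix (\<lambda>x. dpiac_rhs L m d k1 k3 x 0)"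

definition dpiac_B ::
  "real^'n::finite^'n \<Rightarrow> real \<Rightarrow> real \<Rightarrow> real \<Rightarrow> real \<Rightarrow> real^'n^('n + 'n + 'n + 'n)" where
  "dpiac_B L m d k1 k3 = matrix (\<lambda>w. dpiac_rhs L m d k1 k3 0 w)"

text \<open>\<open>\<parallel>G\<^sub>d(\<omega>,w)\<parallel>\<^sup>2\<close> and \<open>\<parallel>G\<^sub>d(u,w)\<parallel>\<^sup>2\<close>:\<close>

definition dpiac_h2_omega :: "real^'n::finite^'n \<Rightarrow> real \<Rightarrow> real \<Rightarrow> real \<Rightarrow> real \<Rightarrow> ennreal" where
  "dpiac_h2_omega L m d k1 k3 =
     h2_norm_sq (dpiac_A L m d k1 k3) (dpiac_B L m d k1 k3) (matrix dpiac_omega)"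

definition dpiac_h2_u :: "real^'n::finite^'n \<Rightarrow> real \<Rightarrow> real \<Rightarrow> real \<Rightarrow> real \<Rightarrow> ennreal" where
  "dpiac_h2_u L m d k1 k3 =
     h2_norm_sq (dpiac_A L m d k1 k3) (dpiac_B L m d k1 k3) (matrix (dpiac_u k1))"


section \<open>GBPIAC\<close>

text \<open>The state is \<open>(\<theta>, \<omega>, \<eta>\<^sub>s, \<xi>\<^sub>s)\<close>, with the two scalars as vectors in \<open>real^1\<close>;
  \<open>vec 1\<close> is the all-ones vector.\<close>

definition gbpiac_omega :: "real^('n::finite + 'n + 1 + 1) \<Rightarrow> real^'n" where
  "gbpiac_omega x = block2 x"

definition gbpiac_u :: "real \<Rightarrow> real^('n::finite + 'n + 1 + 1) \<Rightarrow> real^'n" where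
  "gbpiac_u k1 x = (4 * k1 * (block4 x $ 1) / real CARD('n)) *\<^sub>R vec 1"

definition gbpiac_rhs ::
  "real^'n::finite^'n \<Rightarrow> real \<Rightarrow> real \<Rightarrow> real \<Rightarrow>
   real^('n + 'n + 1 + 1) \<Rightarrow> real^'n \<Rightarrow> real^('n + 'n + 1 + 1)" where
  "gbpiac_rhs L m d k1 x w =
     (let \<theta> = block1 x; \<omega> = block2 x; \<eta>s = block3 x $ 1; \<xi>s = block4 x $ 1 in
      stack4
        \<omega>
        ((1 / m) *\<^sub>R (- (L *v \<theta>) - d *\<^sub>R \<omega> + (4 * k1 * \<xi>s / real CARD('n)) *\<^sub>R vec 1 + w))
        (vec (d * (vec 1 \<bullet> \<omega>)))
        (vec (- (k1 * m * (vec 1 \<bullet> \<omega>)) - k1 * \<eta>s - 4 * k1 * \<xi>s)))"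

definition gbpiac_A ::
  "real^'n::finite^'n \<Rightarrow> real \<Rightarrow> real \<Rightarrow> real \<Rightarrow> real^('n + 'n + 1 + 1)^('n + 'n + 1 + 1)" where
  "gbpiac_A L m d k1 = matrix (\<lambda>x. gbpiac_rhs L m d k1 x 0)"

definition gbpiac_B ::
  "real^'n::finite^'n \<Rightarrow> real \<Rightarrow> real \<Rightarrow> real \<Rightarrow> real^'n^('n + 'n + 1 + 1)" where
  "gbpiac_B L m d k1 = matrix (\<lambda>w. gbpiac_rhs L m d k1 0 w)"

text \<open>\<open>\<parallel>G\<^sub>c(\<omega>,w)\<parallel>\<^sup>2\<close> and \<open>\<parallel>G\<^sub>c(u,w)\<parallel>\<^sup>2\<close>:\<close>

definition gbpiac_h2_omega :: "real^'n::finite^'n \<Rightarrow> real \<Rightarrow> real \<Rightarrow> real \<Rightarrow> ennreal" where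
  "gbpiac_h2_omega L m d k1 =
     h2_norm_sq (gbpiac_A L m d k1) (gbpiac_B L m d k1) (matrix gbpiac_omega)"

definition gbpiac_h2_u :: "real^'n::finite^'n \<Rightarrow> real \<Rightarrow> real \<Rightarrow> real \<Rightarrow> ennreal" where
  "gbpiac_h2_u L m d k1 =
     h2_norm_sq (gbpiac_A L m d k1) (gbpiac_B L m d k1) (matrix (gbpiac_u k1))"


section \<open>The matrices represent the systems\<close>

lemma matrix_works_real: "linear f \<Longrightarrow> matrix f *v x = f x" for f :: "real^'a::finite \<Rightarrow> real^'b"
  by (simp add: matrix_works linear_matrix_vector_mul_eq)

lemma dpiac_state_space:
  "dpiac_A L m d k1 k3 *v x + dpiac_B L m d k1 k3 *v w = dpiac_rhs L m d k1 k3 x w"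
proof -
  have 1: "linear (\<lambda>x. dpiac_rhs L m d k1 k3 x 0)"
    by (rule linearI)
      (auto simp: dpiac_rhs_def stack_defs vec_eq_iff Let_def matrix_vector_mult_def
        algebra_simps sum.distrib sum_distrib_left sum_distrib_right add_divide_distrib diff_divide_distrib
        split: sum.splits)
  have 2: "linear (\<lambda>w. dpiac_rhs L m d k1 k3 0 w)"
    by (rule linearI)
      (auto simp: dpiac_rhs_def stack_defs vec_eq_iff Let_def matrix_vector_mult_def
        algebra_simps add_divide_distrib split: sum.splits)
  show ?thesis
    unfolding dpiac_A_def dpiac_B_def matrix_works_real[OF 1] matrix_works_real[OF 2]
    by (auto simp: dpiac_rhs_def stack_defs vec_eq_iff Let_def matrix_vector_mult_def
        algebra_simps add_divide_distrib split: sum.splits)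
qed

lemma gbpiac_state_space:
  "gbpiac_A L m d k1 *v x + gbpiac_B L m d k1 *v w = gbpiac_rhs L m d k1 x w"
proof -
  have 1: "linear (\<lambda>x. gbpiac_rhs L m d k1 x 0)"
    by (rule linearI)
      (auto simp: gbpiac_rhs_def stack_defs vec_eq_iff Let_def matrix_vector_mult_def inner_vec_def
        algebra_simps sum.distrib sum_distrib_left sum_distrib_right add_divide_distrib diff_divide_distrib
        split: sum.splits)
  have 2: "linear (\<lambda>w. gbpiac_rhs L m d k1 0 w)"
    by (rule linearI)
      (auto simp: gbpiac_rhs_def stack_defs vec_eq_iff Let_def matrix_vector_mult_def inner_vec_def
        algebra_simps add_divide_distrib split: sum.splits)
  show ?thesis
    unfolding gbpiac_A_def gbpiac_B_def matrix_works_real[OF 1] matrix_works_real[OF 2]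
    by (auto simp: gbpiac_rhs_def stack_defs vec_eq_iff Let_def matrix_vector_mult_def inner_vec_def
        algebra_simps add_divide_distrib split: sum.splits)
qed

lemma output_matrices:
  "matrix dpiac_omega *v x = dpiac_omega x"
  "matrix (dpiac_u k1) *v x = dpiac_u k1 x"
  "matrix gbpiac_omega *v y = gbpiac_omega y"
  "matrix (gbpiac_u k1) *v y = gbpiac_u k1 y"
proof -
  have 1: "linear dpiac_omega" "linear (dpiac_u k1)" "linear gbpiac_omega" "linear (gbpiac_u k1)"
    by (rule linearI;
        simp add: dpiac_omega_def dpiac_u_def gbpiac_omega_def gbpiac_u_def stack_defs vec_eq_iff
          algebra_simps add_divide_distrib)+
  show "matrix dpiac_omega *v x = dpiac_omega x" "matrix (dpiac_u k1) *v x = dpiac_u k1 x"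
    "matrix gbpiac_omega *v y = gbpiac_omega y" "matrix (gbpiac_u k1) *v y = gbpiac_u k1 y"
    by (intro matrix_works_real 1)+
qed

end

theory Submission
  imports Defs
begin

text \<open>An orthonormal eigenbasis of \<open>L\<close> splits each squared norm into a sum of scalar integrals,
  one for every eigenvector \<open>v\<close>: started in \<open>B v\<close>, the state keeps all its blocks on the line
  through \<open>v\<close>. For the kernel vector \<open>1 / \<surd>n\<close> both closed loops reduce to the same three-dimensional
  stable system, independent of \<open>k3\<close>, whose integrals come from explicit quadratic forms.

  For an eigenvalue \<open>l > 0\<close> the GBPIAC mode is a damped oscillator, and its energy \<open>F\<close> satisfies
  \<open>F' = - d \<omega>\<^sup>2\<close>. The DPIAC mode is the same oscillator driven by the control input; a Lyapunov function
  \<open>Z\<close> whose decay rate is uniform in \<open>k3\<close> bounds the integral of \<open>u\<^sup>2\<close> by \<open>O(1 / k3)\<close>. So the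
  perturbation of the energy balance vanishes in the limit and only \<open>F(0) / d = 1 / (2 m d)\<close> is left.\<close>

section \<open>Spectral decomposition of the Laplacian\<close>

text \<open>Neither state matrix is Hurwitz, since \<theta> constant with all other states zero is
  an equilibrium. The norms are therefore evaluated as integrals, mode by mode, where \<theta>
  decouples from the kernel mode. The obstacle is the limit. In a mode with eigenvalue l > 0 put u =
  4 k \<xi> and p = m \<omega> + \<eta>. Then p' = - l \<theta> + q^2 u with q^2 = 1 + k3 l, and u'
  = - 4 k^2 p - 4 k u. For frozen \<theta> the pair (p, u) oscillates with a frequency of order q,
  while its damping rate stays at 2 k. So there is no regular limit system to compare with, and
  since p starts at 1 the fast oscillation does not become small. Only u does, being of size 1 / q
  relative to p. Hence the weight q on the control variable, and hence also the subtraction of the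
  equilibrium belonging to frozen \<theta>: the term - l \<theta> in p' would otherwise leave a
  coupling that does not vanish as q grows.\<close>

lemma quadratic_form_max_eigenvector:
  fixes f :: "'a::euclidean_space \<Rightarrow> 'a"
  assumes lin: "linear f" and sa: "\<And>x y. f x \<bullet> y = x \<bullet> f y"
    and S: "subspace S" and inv: "\<And>x. x \<in> S \<Longrightarrow> f x \<in> S"
    and u: "u \<in> S" "norm u = 1"
    and max: "\<And>x. x \<in> S \<Longrightarrow> norm x = 1 \<Longrightarrow> x \<bullet> f x \<le> u \<bullet> f u"
  shows "f u = (u \<bullet> f u) *\<^sub>R u"
proof -
  define M where "M = u \<bullet> f u"
  define r where "r = f u - M *\<^sub>R u"
  have le: "x \<bullet> f x \<le> M * (x \<bullet> x)" if "x \<in> S" for x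
  proof (cases "x = 0")
    case True
    then show ?thesis using linear_0[OF lin] by simp
  next
    case False
    define y where "y = (1 / norm x) *\<^sub>R x"
    have "y \<in> S" "norm y = 1"
      using that S False by (auto simp: y_def subspace_scale)
    then have "y \<bullet> f y \<le> M" using max by (simp add: M_def)
    moreover have "y \<bullet> f y = (x \<bullet> f x) / (x \<bullet> x)"
      by (simp add: y_def linear_cmul[OF lin] norm_eq_sqrt_inner)
    ultimately show ?thesis using False by (simp add: divide_simps mult.commute)
  qed
  have r: "r \<in> S"
    unfolding r_def using S u inv by (intro subspace_diff subspace_scale) auto
  define a K where "a = r \<bullet> r" and "K = M * a - r \<bullet> f r"
  have K: "K \<ge> 0" using le[OF r] by (simp add: K_def a_def)
  have a: "a \<ge> 0" by (simp add: a_def)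
  \<comment> \<open>Maximality along \<open>u + t *\<^sub>R r\<close> yields
    \<open>2 * t * a \<le> t\<^sup>2 * K\<close>. This step length has \<open>t * K \<le> a\<close>,
    hence \<open>2 * a \<le> a\<close> if \<open>a > 0\<close>; the summand 1 keeps the denominator
    positive when \<open>K = 0\<close>.\<close>
  define t where "t = a / (K + 1)"
  have t: "t \<ge> 0" using a K by (simp add: t_def)
  have uu: "u \<bullet> u = 1" using u(2) by (simp add: norm_eq_1)
  have "u + t *\<^sub>R r \<in> S" using S u r by (intro subspace_add subspace_scale) auto
  from le[OF this] have "2 * t * (r \<bullet> f u) - 2 * t * M * (u \<bullet> r) \<le> t\<^sup>2 * K"
    by (simp add: linear_add[OF lin] linear_cmul[OF lin] inner_add_left inner_add_right uu
        M_def[symmetric] K_def a_def sa[of u r, symmetric] inner_commute[of r u]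
        inner_commute[of r "f u"] power2_eq_square algebra_simps)
  moreover have "r \<bullet> f u - M * (u \<bullet> r) = a"
    by (simp add: a_def r_def inner_diff_left inner_diff_right inner_commute algebra_simps)
  ultimately have h: "2 * t * a \<le> t\<^sup>2 * K" by (simp add: algebra_simps)
  have "a = 0"
  proof (rule ccontr)
    assume "a \<noteq> 0"
    then have "t > 0" "a > 0" using a K by (auto simp: t_def)
    then have "2 * a \<le> t * K" using h by (simp add: power2_eq_square)
    also have "t * K \<le> a" using K \<open>a > 0\<close> by (simp add: t_def divide_simps)
    finally show False using \<open>a > 0\<close> by simp
  qed
  then show ?thesis by (simp add: a_def r_def M_def)
qed

text \<open>Induction on the dimension: a maximiser of \<open>x \<bullet> f x\<close> on the compact
  unit sphere of \<open>S\<close> is an eigenvector, and its orthogonal complement in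
  \<open>S\<close> is again invariant because \<open>f\<close> is self-adjoint. The form for
  invariant subspaces carries the induction and is later applied to the hyperplane orthogonal to the
  constants.\<close>

theorem selfadjoint_orthonormal_eigenbasis:
  fixes f :: "'a::euclidean_space \<Rightarrow> 'a"
  assumes lin: "linear f" and sa: "\<And>x y. f x \<bullet> y = x \<bullet> f y"
    and "subspace S" and "\<And>x. x \<in> S \<Longrightarrow> f x \<in> S"
  shows "\<exists>B. pairwise orthogonal B \<and> (\<forall>v\<in>B. norm v = 1 \<and> (\<exists>\<mu>. f v = \<mu> *\<^sub>R v)) \<and> span B = S"
  using assms(3,4)
proof (induction "dim S" arbitrary: S rule: less_induct)
  case less
  show ?case
  proof (cases "S \<subseteq> {0}")
    case True
    then have "S = {0}" using less.prems(1) subspace_0 by blast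
    then show ?thesis by (intro exI[of _ "{}"]) auto
  next
    case False
    then obtain x where x: "x \<in> S" "x \<noteq> 0" by auto
    let ?K = "S \<inter> sphere 0 1"
    have "(1 / norm x) *\<^sub>R x \<in> ?K" using x less.prems(1) by (auto simp: subspace_scale)
    moreover have "compact ?K"
      by (metis Int_commute closed_subspace compact_Int_closed compact_sphere less.prems(1))
    moreover have "continuous_on ?K (\<lambda>x. x \<bullet> f x)"
      by (intro continuous_intros linear_continuous_on_compose[OF _ lin, of _ "\<lambda>x. x", simplified])
    ultimately obtain u where u: "u \<in> ?K" "\<And>y. y \<in> ?K \<Longrightarrow> y \<bullet> f y \<le> u \<bullet> f u"
      using continuous_attains_sup[of ?K "\<lambda>x. x \<bullet> f x"] by blast
    then have uS: "u \<in> S" and nu: "norm u = 1" by auto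
    have fu: "f u = (u \<bullet> f u) *\<^sub>R u"
      by (rule quadratic_form_max_eigenvector[OF lin sa less.prems(1)])
        (use less.prems(2) u in auto)
    define T where "T = {y \<in> S. u \<bullet> y = 0}"
    have T: "subspace T"
      using less.prems(1) by (auto simp: T_def subspace_def inner_add_right)
    have invT: "f y \<in> T" if "y \<in> T" for y
    proof -
      have "u \<bullet> f y = (u \<bullet> f u) * (u \<bullet> y)" by (metis sa fu inner_scaleR_left)
      then show ?thesis using that less.prems(2) by (simp add: T_def)
    qed
    have "u \<notin> T" using nu by (auto simp: T_def)
    moreover have "T \<subseteq> S" by (auto simp: T_def)
    ultimately have "T \<subset> S" using uS by blast
    then have "dim T < dim S"
      by (intro dim_psubset) (metis T less.prems(1) span_eq_iff)
    from less.hyps[OF this T invT] obtain B where B: "pairwise orthogonal B"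
      "\<And>v. v \<in> B \<Longrightarrow> norm v = 1 \<and> (\<exists>\<mu>. f v = \<mu> *\<^sub>R v)" "span B = T" by blast
    have BT: "B \<subseteq> T" using B(3) span_superset by blast
    have "span (insert u B) = S"
    proof
      show "span (insert u B) \<subseteq> S"
        using BT uS less.prems(1) by (intro span_minimal) (auto simp: T_def)
      show "S \<subseteq> span (insert u B)"
      proof
        fix y assume y: "y \<in> S"
        have "y - (u \<bullet> y) *\<^sub>R u \<in> T"
          using y uS less.prems(1) nu
          by (auto simp: T_def subspace_diff subspace_scale inner_diff_right norm_eq_1)
        then show "y \<in> span (insert u B)"
          unfolding span_insert B(3) by blast
      qed
    qed
    moreover have "pairwise orthogonal (insert u B)"
      using B(1) BT by (auto simp: pairwise_insert orthogonal_def T_def inner_commute)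
    ultimately show ?thesis
      using B(2) nu fu by (intro exI[of _ "insert u B"]) auto
  qed
qed

section \<open>Kernel and positivity of the Laplacian of a connected graph\<close>

text \<open>The diagonal entries are the row sums of the weights, so the Laplacian acts by weighted
  differences along edges. Both the kernel and the maximum principle are read off from this
  form.\<close>

lemma laplacian_vec_nth:
  assumes "connected_weighted_graph E c"
  shows "(laplacian E c *v v) $ i = (\<Sum>k | (i, k) \<in> E. c i k * (v $ i - v $ k))"
proof -
  have irr: "(i, i) \<notin> E" using assms by (auto simp: connected_weighted_graph_def irrefl_def)
  have "(laplacian E c *v v) $ i = (\<Sum>j\<in>UNIV. (if j = i then (\<Sum>k | (i, k) \<in> E. c i k) * v $ i else 0)
       - (if (i, j) \<in> E then c i j * v $ j else 0))"
    unfolding matrix_vector_mult_def laplacian_def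
    by (auto intro!: sum.cong simp: irr)
  also have "\<dots> = (\<Sum>k | (i, k) \<in> E. c i k) * v $ i - (\<Sum>j | (i, j) \<in> E. c i j * v $ j)"
    by (simp add: sum_subtractf sum.inter_filter[symmetric])
  finally show ?thesis
    by (simp add: sum_distrib_right sum_subtractf right_diff_distrib)
qed

lemma transpose_laplacian:
  assumes "connected_weighted_graph E c"
  shows "transpose (laplacian E c) = laplacian E c"
proof -
  have "(j, i) \<in> E \<and> c i j = c j i" if "(i, j) \<in> E" for i j
    using assms that by (auto simp: connected_weighted_graph_def sym_def)
  then show ?thesis by (auto simp: transpose_def laplacian_def vec_eq_iff)
qed

lemma laplacian_ones:
  assumes "connected_weighted_graph E c"
  shows "laplacian E c *v vec 1 = 0"
  using assms by (simp add: vec_eq_iff laplacian_vec_nth)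

text \<open>Maximum principle: where \<open>v\<close> is maximal, \<open>L v \<ge> 0\<close>; if \<open>\<mu> \<le> 0\<close>, equality propagates the
  maximum along all edges, so that \<open>v\<close> is constant.\<close>

lemma laplacian_eigenvalue_pos:
  fixes v :: "real^'n::finite"
  assumes G: "connected_weighted_graph E c" and ev: "laplacian E c *v v = \<mu> *\<^sub>R v"
    and orth: "vec 1 \<bullet> v = 0" and v: "v \<noteq> 0"
  shows "\<mu> > 0"
proof (rule ccontr)
  assume "\<not> \<mu> > 0"
  have sum0: "(\<Sum>i\<in>UNIV. v $ i) = 0" using orth by (simp add: inner_vec_def)
  define M where "M = Max (range (\<lambda>i. v $ i))"
  have le: "v $ i \<le> M" for i by (simp add: M_def)
  have "M \<in> range (\<lambda>i. v $ i)" unfolding M_def by (rule Max_in) auto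
  then obtain i0 where i0: "v $ i0 = M" by auto
  \<comment> \<open>The entries of \<open>v\<close> sum to zero, so their maximum cannot be
    negative. With the negated claim this sign gives \<open>\<mu> * M \<le> 0\<close>.\<close>
  have M: "M \<ge> 0"
  proof (rule ccontr)
    assume "\<not> M \<ge> 0"
    then have "v $ i < 0" for i using le[of i] by linarith
    then have "(\<Sum>i\<in>UNIV. v $ i) < 0" by (intro sum_strict_mono[of UNIV _ "\<lambda>_. 0", simplified]) auto
    with sum0 show False by simp
  qed
  have step: "v $ j = M" if "v $ i = M" "(i, j) \<in> E" for i j
  proof -
    have pos: "c i k > 0" if "(i, k) \<in> E" for k
      using G that by (auto simp: connected_weighted_graph_def)
    have "(\<Sum>k | (i, k) \<in> E. c i k * (v $ i - v $ k)) = \<mu> * M"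
      using laplacian_vec_nth[OF G, of v i] ev that(1) by simp
    also have "\<dots> \<le> 0" using M \<open>\<not> \<mu> > 0\<close> by (simp add: mult_nonpos_nonneg)
    finally have le0: "(\<Sum>k | (i, k) \<in> E. c i k * (v $ i - v $ k)) \<le> 0" .
    have nn: "c i k * (v $ i - v $ k) \<ge> 0" if "(i, k) \<in> E" for k
      using pos[OF that] le[of k] \<open>v $ i = M\<close> by simp
    have "(\<Sum>k | (i, k) \<in> E. c i k * (v $ i - v $ k)) = 0"
      using le0 nn by (intro antisym sum_nonneg) auto
    then have "c i j * (v $ i - v $ j) = 0"
      using nn that(2) by (subst (asm) sum_nonneg_eq_0_iff) auto
    then show ?thesis using pos[OF that(2)] that(1) by simp
  qed
  have all: "v $ j = M" for j
  proof -
    have "(i0, j) \<in> E\<^sup>*" using G by (auto simp: connected_weighted_graph_def)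
    then show ?thesis by (induction rule: rtrancl_induct) (use i0 step in auto)
  qed
  with sum0 have "M = 0" by simp
  with all v show False by (simp add: vec_eq_iff)
qed

text \<open>The kernel vector is fixed as a multiple of \<open>vec 1\<close> because the GBPIAC
  feedback acts along exactly this vector. The other eigenvectors come from the orthogonal
  hyperplane, of dimension n - 1.\<close>

lemma laplacian_orthonormal_eigenbasis:
  fixes E :: "('n::finite \<times> 'n) set"
  assumes G: "connected_weighted_graph E c"
  obtains B :: "(real^'n) set" where "\<And>v. v \<in> B \<Longrightarrow> norm v = 1"
    "finite B" "card B = CARD('n) - 1" "\<And>v. v \<in> B \<Longrightarrow> vec 1 \<bullet> v = 0"
    "\<And>v. v \<in> B \<Longrightarrow> \<exists>\<mu> > 0. laplacian E c *v v = \<mu> *\<^sub>R v"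
    "pairwise orthogonal (insert ((1 / sqrt (real CARD('n))) *\<^sub>R vec 1) B)"
    "span (insert ((1 / sqrt (real CARD('n))) *\<^sub>R vec 1) B) = UNIV"
proof -
  let ?L = "laplacian E c"
  let ?e = "(1 / sqrt (real CARD('n))) *\<^sub>R (vec 1 :: real^'n)"
  define S where "S = {x :: real^'n. vec 1 \<bullet> x = 0}"
  have S: "subspace S" unfolding S_def by (rule subspace_hyperplane)
  have sa: "(?L *v x) \<bullet> y = x \<bullet> (?L *v y)" for x y
    by (metis dot_lmul_matrix transpose_laplacian[OF G] transpose_matrix_vector)
  have inv: "?L *v x \<in> S" if "x \<in> S" for x
    using sa[of "vec 1" x] unfolding S_def laplacian_ones[OF G] by simp
  obtain B where B: "pairwise orthogonal B" "span B = S"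
    and nB: "\<And>v. v \<in> B \<Longrightarrow> norm v = 1 \<and> (\<exists>\<mu>. ?L *v v = \<mu> *\<^sub>R v)"
    using selfadjoint_orthonormal_eigenbasis[OF matrix_vector_mul_linear sa S inv] by blast
  have BS: "B \<subseteq> S" using B(2) span_superset by blast
  have "0 \<notin> B" using nB by force
  then have ind: "independent B" using B(1) by (simp add: pairwise_orthogonal_independent)
  then have fin: "finite B" by (rule independent_imp_finite)
  have one: "(vec 1 :: real^'n) \<noteq> 0" by (simp add: vec_eq_iff)
  have "card B = dim S" using ind B(2) by (metis dim_span dim_eq_card_independent)
  then have card: "card B = CARD('n) - 1"
    unfolding S_def using dim_hyperplane[OF one] by simp
  have pos: "\<exists>\<mu> > 0. ?L *v v = \<mu> *\<^sub>R v" if v: "v \<in> B" for v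
  proof -
    obtain \<mu> where "?L *v v = \<mu> *\<^sub>R v" using nB[OF v] by blast
    moreover have "v \<noteq> 0" "vec 1 \<bullet> v = 0" using v \<open>0 \<notin> B\<close> BS by (auto simp: S_def)
    ultimately show ?thesis using laplacian_eigenvalue_pos[OF G] by blast
  qed
  have orth: "pairwise orthogonal (insert ?e B)"
    using B(1) BS by (auto simp: pairwise_insert orthogonal_def S_def inner_commute)
  have "x \<in> span (insert ?e B)" for x :: "real^'n"
  proof -
    have "vec 1 \<bullet> (vec 1 :: real^'n) = real CARD('n)" by (simp add: inner_vec_def)
    then have "x - (vec 1 \<bullet> x / sqrt (real CARD('n))) *\<^sub>R ?e \<in> S"
      by (simp add: S_def inner_diff_right)
    then show ?thesis unfolding span_insert B(2) by blast
  qed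
  then have sp: "span (insert ?e B) = UNIV" by blast
  show thesis
    by (rule that[OF _ fin card _ pos orth sp]) (use nB BS in \<open>auto simp: S_def\<close>)
qed

section \<open>The matrix exponential\<close>

lemma sums_vecI:
  fixes f :: "nat \<Rightarrow> 'a::real_normed_vector^'n::finite"
  assumes "\<And>i. (\<lambda>k. f k $ i) sums (s $ i)"
  shows "f sums s"
  using assms unfolding sums_def by (intro vec_tendstoI) (simp add: sum_component)

lemma mat_pow_0 [simp]: "mat_pow A 0 = mat 1"
  by (simp add: mat_pow_def)

lemma mat_pow_Suc: "mat_pow A (Suc k) = A ** mat_pow A k"
  by (simp add: mat_pow_def)

lemma mat_pow_Suc': "mat_pow A (Suc k) = mat_pow A k ** A"
  by (induction k) (simp_all add: mat_pow_Suc matrix_mul_assoc)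

lemma mat_pow_scaleR: "mat_pow (t *\<^sub>R A) k = t ^ k *\<^sub>R mat_pow A k"
proof (induction k)
  case (Suc k)
  then show ?case
    by (simp add: mat_pow_Suc matrix_scalar_ac scalar_matrix_assoc[symmetric] mult.commute)
qed simp

lemma mat_pow_transpose: "mat_pow (transpose A) k = transpose (mat_pow A k)"
  by (induction k) (simp_all add: mat_pow_Suc mat_pow_Suc'[symmetric] matrix_transpose_mul[symmetric])

text \<open>An entry is at most the norm of its column, which is the image of a unit vector. The
  bound is the majorant for the exponential series.\<close>

lemma mat_pow_component_le: "\<bar>mat_pow A k $ i $ j\<bar> \<le> onorm ((*v) A) ^ k"
proof -
  have "norm (mat_pow A k *v x) \<le> onorm ((*v) A) ^ k * norm x" for x
  proof (induction k)
    case (Suc k)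
    have "norm (mat_pow A (Suc k) *v x) = norm (A *v (mat_pow A k *v x))"
      by (simp add: mat_pow_Suc matrix_vector_mul_assoc)
    also have "\<dots> \<le> onorm ((*v) A) * norm (mat_pow A k *v x)"
      by (rule onorm[OF matrix_vector_mul_bounded_linear])
    also have "\<dots> \<le> onorm ((*v) A) * (onorm ((*v) A) ^ k * norm x)"
      by (intro mult_left_mono Suc onorm_pos_le matrix_vector_mul_bounded_linear)
    finally show ?case by simp
  qed simp
  from this[of "axis j 1"] have "norm (column j (mat_pow A k)) \<le> onorm ((*v) A) ^ k"
    by (simp add: matrix_vector_mult_basis)
  then show ?thesis
    using component_le_norm_cart[of "column j (mat_pow A k)" i] by (simp add: column_def)
qed

text \<open>Written as a scalar power series in \<open>t\<close>, so that termwise differentiation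
  applies to each entry.\<close>

lemma summable_mat_exp_component:
  "summable (\<lambda>k. (mat_pow A k $ i $ j / fact k) * t ^ k)"
proof (rule summable_comparison_test')
  show "summable (\<lambda>k. inverse (fact k) * (onorm ((*v) A) * \<bar>t\<bar>) ^ k)"
    by (rule summable_exp)
  show "norm ((mat_pow A k $ i $ j / fact k) * t ^ k) \<le> inverse (fact k) * (onorm ((*v) A) * \<bar>t\<bar>) ^ k" for k
    using mult_right_mono[OF mat_pow_component_le[of A k i j], of "\<bar>t\<bar> ^ k / fact k"]
    by (simp add: abs_mult power_abs power_mult_distrib field_simps)
qed

lemma mat_exp_sums: "(\<lambda>k. (t ^ k / fact k) *\<^sub>R mat_pow A k) sums mat_exp (t *\<^sub>R A)"
proof -
  have "(\<lambda>k. (t ^ k / fact k) *\<^sub>R mat_pow A k)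
      sums (\<chi> i j. \<Sum>k. (mat_pow A k $ i $ j / fact k) * t ^ k)"
    using summable_mat_exp_component[of A _ _ t]
    by (intro sums_vecI) (simp add: summable_sums mult.commute)
  then show ?thesis
    by (simp add: mat_exp_def mat_pow_scaleR sums_iff)
qed

lemma mat_exp_component:
  "mat_exp (t *\<^sub>R A) $ i $ j = (\<Sum>k. (mat_pow A k $ i $ j / fact k) * t ^ k)"
proof -
  have "(\<lambda>k. ((t ^ k / fact k) *\<^sub>R mat_pow A k) $ i $ j) sums (mat_exp (t *\<^sub>R A) $ i $ j)"
    using tendsto_vec_nth[OF tendsto_vec_nth[OF mat_exp_sums[of t A, unfolded sums_def]], of i j]
    by (simp add: sums_def sum_component)
  then show ?thesis by (simp add: sums_iff mult.commute)
qed

lemma mat_exp_0 [simp]: "mat_exp (0 *\<^sub>R A) = mat 1"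
proof -
  have "(\<lambda>k. (0 ^ k / fact k) *\<^sub>R mat_pow A k) = (\<lambda>k. if k = 0 then mat_pow A k else 0)"
    by (auto simp: fun_eq_iff)
  then have "(\<lambda>k. (0 ^ k / fact k) *\<^sub>R mat_pow A k) sums mat_pow A 0"
    using sums_single[of 0 "mat_pow A"] by simp
  then show ?thesis using mat_exp_sums[of 0 A] sums_unique2 by fastforce
qed

lemma mat_exp_transpose: "mat_exp (t *\<^sub>R transpose A) = transpose (mat_exp (t *\<^sub>R A))"
  unfolding vec_eq_iff mat_exp_component mat_pow_transpose by (simp add: transpose_def mat_exp_component)

lemma mat_exp_vector_has_derivative:
  fixes A :: "real^'s::finite^'s"
  shows "((\<lambda>t. (mat_exp (t *\<^sub>R A) *v x) $ i) has_real_derivative (A *v (mat_exp (t *\<^sub>R A) *v x)) $ i) (at t)"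
proof -
  have D: "((\<lambda>t. mat_exp (t *\<^sub>R A) $ i $ j) has_real_derivative (A ** mat_exp (t *\<^sub>R A)) $ i $ j) (at t)" for j
  proof -
    have "((\<lambda>t. \<Sum>k. (mat_pow A k $ i $ j / fact k) * t ^ k) has_real_derivative
        (\<Sum>k. diffs (\<lambda>k. mat_pow A k $ i $ j / fact k) k * t ^ k)) (at t)"
      by (rule termdiffs_strong_converges_everywhere[OF summable_mat_exp_component])
    \<comment> \<open>Differentiation shifts the index, and
      \<open>Suc k / fact (Suc k) = 1 / fact k\<close>; the additional factor \<open>A\<close> is
      then pulled out of the series.\<close>
    moreover have "diffs (\<lambda>k. mat_pow A k $ i $ j / fact k) k * t ^ k
        = (\<Sum>l\<in>UNIV. A $ i $ l * (mat_pow A k $ l $ j / fact k * t ^ k))" for k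
    proof -
      have "diffs (\<lambda>k. mat_pow A k $ i $ j / fact k) k = mat_pow A (Suc k) $ i $ j / fact k"
        by (simp add: diffs_def field_simps del: of_nat_Suc)
      then show ?thesis
        by (simp add: mat_pow_Suc matrix_matrix_mult_def sum_divide_distrib sum_distrib_right mult.assoc)
    qed
    moreover have "(\<Sum>k. \<Sum>l\<in>UNIV. A $ i $ l * (mat_pow A k $ l $ j / fact k * t ^ k))
        = (A ** mat_exp (t *\<^sub>R A)) $ i $ j"
      unfolding matrix_matrix_mult_def vec_lambda_beta mat_exp_component
      by (subst suminf_sum)
        (simp_all only: summable_mult suminf_mult summable_mat_exp_component)
    ultimately show ?thesis by (simp add: mat_exp_component)
  qed
  have "((\<lambda>t. (mat_exp (t *\<^sub>R A) *v x) $ i) has_real_derivative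
      ((A ** mat_exp (t *\<^sub>R A)) *v x) $ i) (at t)"
    unfolding matrix_vector_mult_def by (auto intro!: derivative_eq_intros D)
  then show ?thesis by (simp add: matrix_vector_mul_assoc)
qed

text \<open>The partial sums of the series stay in \<open>S\<close>, and a subspace is closed in
  finite dimension. This is what confines a mode to the line through its eigenvector.\<close>

lemma mat_exp_in_invariant_subspace:
  fixes A :: "real^'s::finite^'s"
  assumes S: "subspace S" and inv: "\<And>x. x \<in> S \<Longrightarrow> A *v x \<in> S" and x: "x \<in> S"
  shows "mat_exp (t *\<^sub>R A) *v x \<in> S"
proof -
  have pow: "mat_pow A k *v x \<in> S" for k
    by (induction k) (use x inv in \<open>simp_all add: mat_pow_Suc flip: matrix_vector_mul_assoc\<close>)
  have "bounded_linear (\<lambda>M. M *v x)"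
    unfolding linear_conv_bounded_linear[symmetric]
    by (rule linearI) (simp_all add: matrix_vector_mult_add_rdistrib scaleR_matrix_vector_assoc)
  from bounded_linear.sums[OF this mat_exp_sums]
  have "(\<lambda>k. (t ^ k / fact k) *\<^sub>R (mat_pow A k *v x)) sums (mat_exp (t *\<^sub>R A) *v x)"
    by (simp add: scaleR_matrix_vector_assoc)
  then show ?thesis
    unfolding sums_def
    by (rule Lim_in_closed_set[rotated 3])
      (auto intro!: closed_subspace S always_eventually subspace_sum subspace_scale pow)
qed

section \<open>The squared H2 norm in an arbitrary orthonormal basis of inputs\<close>

lemma norm_sq_orthonormal_basis:
  fixes B :: "'a::euclidean_space set"
  assumes "pairwise orthogonal B" "\<And>v. v \<in> B \<Longrightarrow> norm v = 1" "span B = UNIV" "finite B"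
  shows "(norm x)\<^sup>2 = (\<Sum>v\<in>B. (x \<bullet> v)\<^sup>2)"
proof -
  have "x \<bullet> x = x \<bullet> (\<Sum>v\<in>B. (x \<bullet> v) *\<^sub>R v)"
    using orthonormal_basis_expand[of B x] assms by simp
  also have "\<dots> = (\<Sum>v\<in>B. (x \<bullet> v)\<^sup>2)"
    by (simp only: inner_sum_right inner_scaleR_right power2_eq_square)
  finally show ?thesis by (simp only: power2_norm_eq_inner)
qed

text \<open>The trace is the sum of the squared entries of \<open>M\<close>. Parseval, applied to
  each row, exchanges the standard basis for \<open>B\<close>.\<close>

lemma trace_gram_orthonormal_basis:
  fixes M :: "real^'i::finite^'o::finite"
  assumes B: "pairwise orthogonal B" "\<And>v. v \<in> B \<Longrightarrow> norm v = 1" "span B = UNIV" "finite B"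
  shows "trace (transpose M ** M) = (\<Sum>v\<in>B. (norm (M *v v))\<^sup>2)"
proof -
  have "trace (transpose M ** M) = (\<Sum>j\<in>UNIV. \<Sum>i\<in>UNIV. (M $ i $ j)\<^sup>2)"
    by (simp add: trace_def matrix_matrix_mult_def transpose_def power2_eq_square)
  also have "\<dots> = (\<Sum>i\<in>UNIV. (norm (M $ i))\<^sup>2)"
    by (subst sum.swap) (simp add: norm_vec_def L2_set_def sum_nonneg)
  also have "\<dots> = (\<Sum>i\<in>UNIV. \<Sum>v\<in>B. (M $ i \<bullet> v)\<^sup>2)"
    using norm_sq_orthonormal_basis[OF B] by simp
  also have "\<dots> = (\<Sum>v\<in>B. (norm (M *v v))\<^sup>2)"
    by (subst sum.swap) (simp add: norm_vec_def L2_set_def sum_nonneg matrix_vector_mult_def inner_vec_def)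
  finally show ?thesis .
qed

text \<open>The squared norm is the total output energy of the free motions started in
  \<open>B *v v\<close>. In \<open>[0,\<infinity>]\<close> the splitting of the integral rests on
  measurability alone, which comes from the continuity of the flow.\<close>

lemma h2_norm_sq_orthonormal_basis:
  fixes A :: "real^'s::finite^'s" and C :: "real^'s^'o::finite" and W :: "(real^'i::finite) set"
  assumes W: "pairwise orthogonal W" "\<And>v. v \<in> W \<Longrightarrow> norm v = 1" "span W = UNIV" "finite W"
  shows "h2_norm_sq A B C =
    (\<Sum>v\<in>W. \<integral>\<^sup>+ t \<in> {0..}. ennreal ((norm (C *v (mat_exp (t *\<^sub>R A) *v (B *v v))))\<^sup>2) \<partial>lborel)"
proof -
  have eq: "trace (transpose B ** mat_exp (t *\<^sub>R transpose A) ** transpose C ** C ** mat_exp (t *\<^sub>R A) ** B)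
      = (\<Sum>v\<in>W. (norm (C *v (mat_exp (t *\<^sub>R A) *v (B *v v))))\<^sup>2)" for t
    using trace_gram_orthonormal_basis[OF W, of "C ** mat_exp (t *\<^sub>R A) ** B"]
    by (simp add: mat_exp_transpose matrix_transpose_mul matrix_mul_assoc matrix_vector_mul_assoc)
  have cont: "continuous_on UNIV (\<lambda>t. mat_exp (t *\<^sub>R A) *v x)" for x
    by (intro continuous_at_imp_continuous_on ballI, unfold isCont_def, intro vec_tendstoI)
      (rule DERIV_isCont[OF mat_exp_vector_has_derivative, unfolded isCont_def])
  have meas: "(\<lambda>t. ennreal ((norm (C *v (mat_exp (t *\<^sub>R A) *v x)))\<^sup>2) * indicator {0..} t) \<in> borel_measurable borel" for x
  proof -
    have "(\<lambda>t. (norm (C *v (mat_exp (t *\<^sub>R A) *v x)))\<^sup>2) \<in> borel_measurable borel"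
      by (intro borel_measurable_continuous_onI continuous_intros
          linear_continuous_on_compose[OF cont matrix_vector_mul_linear])
    then show ?thesis by measurable
  qed
  show ?thesis
    unfolding h2_norm_sq_def eq
    by (subst nn_integral_sum[symmetric])
      (auto intro!: nn_integral_cong meas simp: sum_ennreal[symmetric] sum_distrib_right simp del: sum_ennreal)
qed

section \<open>The mode of the kernel of the Laplacian\<close>

text \<open>Gronwall: \<open>Z t * exp (c * t)\<close> is nonincreasing.\<close>

lemma exponential_decay:
  fixes Z Z' :: "real \<Rightarrow> real"
  assumes D: "\<And>t. (Z has_real_derivative Z' t) (at t)" and c: "c > 0"
    and le: "\<And>t. Z' t \<le> - c * Z t" and nn: "\<And>t. Z t \<ge> 0"
  shows "(Z \<longlongrightarrow> 0) at_top"
proof -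
  have *: "Z t * exp (c * t) \<le> Z 0" if "t \<ge> 0" for t
  proof -
    have "Z t * exp (c * t) \<le> Z 0 * exp (c * 0)"
    proof (rule DERIV_nonpos_imp_nonincreasing[OF that])
      fix x :: real
      have "((\<lambda>t. Z t * exp (c * t)) has_real_derivative (Z' x + c * Z x) * exp (c * x)) (at x)"
        by (auto intro!: derivative_eq_intros D simp: algebra_simps)
      moreover have "(Z' x + c * Z x) * exp (c * x) \<le> 0"
        using le[of x] by (intro mult_nonpos_nonneg) auto
      ultimately show "\<exists>y. ((\<lambda>t. Z t * exp (c * t)) has_real_derivative y) (at x) \<and> y \<le> 0"
        by blast
    qed
    then show ?thesis by simp
  qed
  have ev: "eventually (\<lambda>t. Z t \<le> Z 0 * exp (- c * t)) at_top"
    using eventually_ge_at_top[of 0]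
    by eventually_elim (use * in \<open>simp add: exp_minus field_simps\<close>)
  have "filterlim (\<lambda>t. - c * t) at_bot at_top"
    using c by (simp add: filterlim_uminus_at_top[symmetric] filterlim_tendsto_pos_mult_at_top[OF tendsto_const _ filterlim_ident])
  from filterlim_compose[OF exp_at_bot this]
  have "((\<lambda>t. Z 0 * exp (- c * t)) \<longlongrightarrow> 0) at_top"
    by (rule tendsto_mult_right_zero)
  from tendsto_sandwich[OF _ ev tendsto_const this] show ?thesis using nn by simp
qed

text \<open>Energy balance: what is dissipated over all time is the initial storage
  \<open>V 0\<close>, because the storage dies out. All integrals are evaluated this way, without
  solving the differential equations.\<close>

lemma nn_integral_dissipation:
  fixes V f :: "real \<Rightarrow> real"
  assumes "\<And>t. (V has_real_derivative - f t) (at t)" and "\<And>t. f t \<ge> 0"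
    and "continuous_on UNIV f" and "(V \<longlongrightarrow> 0) at_top"
  shows "(\<integral>\<^sup>+ t \<in> {0..}. ennreal (f t) \<partial>lborel) = ennreal (V 0)"
proof -
  have "((\<lambda>t. - V t) has_real_derivative f t) (at t)" for t
    using DERIV_minus[OF assms(1)[of t]] by simp
  moreover have "((\<lambda>t. - V t) \<longlongrightarrow> 0) at_top" using tendsto_minus[OF assms(4)] by simp
  ultimately show ?thesis
    using nn_integral_FTC_atLeast[of f 0 "\<lambda>t. - V t" 0] assms(2,3)
    by (simp add: borel_measurable_continuous_onI)
qed

text \<open>The balance \<open>F' = - f\<close> fails by at most \<open>\<delta> * - Z'\<close>, and
  this error bound integrates to \<open>\<delta> * Z 0\<close>.\<close>

lemma nn_integral_perturbed_dissipation:
  fixes F F' Z Z' f :: "real \<Rightarrow> real"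
  assumes F: "\<And>t. (F has_real_derivative F' t) (at t)" and Z: "\<And>t. (Z has_real_derivative Z' t) (at t)"
    and f: "\<And>t. f t \<ge> 0" "continuous_on UNIV f"
    and cont: "continuous_on UNIV F'" "continuous_on UNIV Z'"
    and lim: "(F \<longlongrightarrow> 0) at_top" "(Z \<longlongrightarrow> 0) at_top"
    and \<delta>: "\<delta> \<ge> 0" "Z 0 \<ge> 0" and le: "\<And>t. \<bar>F' t + f t\<bar> \<le> \<delta> * - Z' t"
  shows "(\<integral>\<^sup>+ t \<in> {0..}. ennreal (f t) \<partial>lborel) \<le> ennreal (F 0 + \<delta> * Z 0)"
    and "ennreal (F 0 - \<delta> * Z 0) \<le> (\<integral>\<^sup>+ t \<in> {0..}. ennreal (f t) \<partial>lborel)"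
proof -
  \<comment> \<open>\<open>?h\<close> lies between \<open>f\<close> and \<open>f\<close> plus twice
    the error bound, and its integral is exactly \<open>F 0 + \<delta> * Z 0\<close>. For the lower
    estimate the number \<open>2 * \<delta> * Z 0\<close> is subtracted at the end, which avoids
    differences of integrals in \<open>[0,\<infinity>]\<close>.\<close>
  let ?h = "\<lambda>t. - F' t + \<delta> * - Z' t"
  have h: "f t \<le> ?h t" "?h t \<le> f t + 2 * \<delta> * - Z' t" for t
    using le[of t] by (auto simp: abs_le_iff)
  have ge: "0 \<le> 2 * \<delta> * - Z' t" for t using le[of t] by simp
  have eq: "(\<integral>\<^sup>+ t \<in> {0..}. ennreal (?h t) \<partial>lborel) = ennreal (F 0 + \<delta> * Z 0)"
  proof (rule nn_integral_dissipation)
    show "((\<lambda>t. F t + \<delta> * Z t) has_real_derivative - ?h t) (at t)" for t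
      by (auto intro!: derivative_eq_intros F Z)
    show "0 \<le> ?h t" for t using f(1)[of t] h(1)[of t] by linarith
    show "((\<lambda>t. F t + \<delta> * Z t) \<longlongrightarrow> 0) at_top"
      using tendsto_add[OF lim(1) tendsto_mult_right_zero[OF lim(2)]] by simp
  qed (intro continuous_intros cont)
  show "(\<integral>\<^sup>+ t \<in> {0..}. ennreal (f t) \<partial>lborel) \<le> ennreal (F 0 + \<delta> * Z 0)"
    unfolding eq[symmetric]
    by (intro nn_integral_mono mult_right_mono ennreal_leI h) auto
  have eq2: "(\<integral>\<^sup>+ t \<in> {0..}. ennreal (2 * \<delta> * - Z' t) \<partial>lborel) = ennreal (2 * \<delta> * Z 0)"
  proof (rule nn_integral_dissipation)
    show "((\<lambda>t. 2 * \<delta> * Z t) has_real_derivative - (2 * \<delta> * - Z' t)) (at t)" for t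
      by (auto intro!: derivative_eq_intros Z)
    show "((\<lambda>t. 2 * \<delta> * Z t) \<longlongrightarrow> 0) at_top"
      by (rule tendsto_mult_right_zero[OF lim(2)])
  qed (use ge in \<open>auto intro!: continuous_intros cont\<close>)
  have meas: "f \<in> borel_measurable borel" "Z' \<in> borel_measurable borel"
    using f(2) cont(2) by (auto intro: borel_measurable_continuous_onI)
  have "ennreal (F 0 + \<delta> * Z 0) \<le>
      (\<integral>\<^sup>+ t. ennreal (f t) * indicator {0..} t + ennreal (2 * \<delta> * - Z' t) * indicator {0..} t \<partial>lborel)"
    unfolding eq[symmetric]
  proof (intro nn_integral_mono)
    fix t
    have "ennreal (?h t) \<le> ennreal (f t) + ennreal (2 * \<delta> * - Z' t)"
      using ennreal_leI[OF h(2)[of t]] f(1)[of t] ge[of t] by (simp only: ennreal_plus)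
    then show "ennreal (?h t) * indicator {0..} t
        \<le> ennreal (f t) * indicator {0..} t + ennreal (2 * \<delta> * - Z' t) * indicator {0..} t"
      by (metis distrib_right mult_right_mono zero_le)
  qed
  also have "\<dots> = (\<integral>\<^sup>+ t \<in> {0..}. ennreal (f t) \<partial>lborel) + ennreal (2 * \<delta> * Z 0)"
    unfolding eq2[symmetric] by (intro nn_integral_add) (use meas in measurable)
  finally have "ennreal (F 0 + \<delta> * Z 0) - ennreal (2 * \<delta> * Z 0) \<le> (\<integral>\<^sup>+ t \<in> {0..}. ennreal (f t) \<partial>lborel)"
    by (simp add: ennreal_minus_le_iff add.commute)
  then show "ennreal (F 0 - \<delta> * Z 0) \<le> (\<integral>\<^sup>+ t \<in> {0..}. ennreal (f t) \<partial>lborel)"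
    using \<delta> by (simp add: ennreal_minus)
qed

section \<open>The critically damped kernel mode\<close>

lemma average_mode_decay:
  fixes \<omega> p u :: "real \<Rightarrow> real"
  assumes pos: "m > 0" "d > 0" "k > 0"
    and \<omega>': "\<And>t. (\<omega> has_real_derivative (- d * \<omega> t + u t) / m) (at t)"
    and p': "\<And>t. (p has_real_derivative u t) (at t)"
    and u': "\<And>t. (u has_real_derivative - 4 * k\<^sup>2 * p t - 4 * k * u t) (at t)"
  shows "(\<omega> \<longlongrightarrow> 0) at_top" "(p \<longlongrightarrow> 0) at_top" "(u \<longlongrightarrow> 0) at_top"
proof -
  \<comment> \<open>The ratio 4 of the two gains gives the equation for \<open>p\<close> the double
    root - 2 k. \<open>r\<close> completes the Jordan chain: \<open>r' = - 2 * k * r\<close> and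
    \<open>p' = r - 2 * k * p\<close>.\<close>
  define r where "r t = u t + 2 * k * p t" for t
  define Y where "Y t = m * (\<omega> t)\<^sup>2 / 2 + 2 * k / d * (p t)\<^sup>2 + (r t)\<^sup>2 / (k * d)" for t
  define Y' where "Y' t = - d * (\<omega> t)\<^sup>2 + \<omega> t * r t - 2 * k * \<omega> t * p t
      + 4 * k / d * p t * r t - 8 * k\<^sup>2 / d * (p t)\<^sup>2 - 4 / d * (r t)\<^sup>2" for t
  have Y: "(Y has_real_derivative Y' t) (at t)" for t
    unfolding Y_def[abs_def] Y'_def r_def using pos
    by (auto intro!: derivative_eq_intros \<omega>' p' u' simp: field_simps power2_eq_square)
  define c where "c = min (d / m) k"
  have c: "c > 0" "c * m \<le> d" "c \<le> k"
    using pos by (auto simp: c_def min_def field_simps split: if_splits)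
  have le: "Y' t \<le> - c * Y t" for t
  proof -
    \<comment> \<open>With weights 1/4, 1/4 and 2 these squares absorb all mixed terms of
      \<open>d * Y' t\<close>; the estimate below is what is left after dropping them.\<close>
    have sq: "0 \<le> (d * \<omega> t - 2 * r t)\<^sup>2" "0 \<le> (d * \<omega> t + 4 * k * p t)\<^sup>2" "0 \<le> (k * p t - r t)\<^sup>2"
      by simp_all
    have "d * Y' t \<le> - d * (d / 2) * (\<omega> t)\<^sup>2 - 2 * k\<^sup>2 * (p t)\<^sup>2 - (r t)\<^sup>2"
    proof -
      have "d * Y' t = - d\<^sup>2 * (\<omega> t)\<^sup>2 + d * \<omega> t * r t - 2 * d * k * \<omega> t * p t
        + 4 * k * p t * r t - 8 * k\<^sup>2 * (p t)\<^sup>2 - 4 * (r t)\<^sup>2"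
        using pos by (simp add: Y'_def field_simps power2_eq_square)
      moreover have "0 \<le> (k * p t - r t)\<^sup>2" "0 \<le> k\<^sup>2 * (p t)\<^sup>2" by simp_all
      ultimately show ?thesis using sq by (simp add: power2_eq_square algebra_simps)
    qed
    also have "\<dots> \<le> - c * (d * Y t)"
    proof -
      have "c * (d * Y t) = (c * m) * (d * (\<omega> t)\<^sup>2 / 2) + c * (2 * k * (p t)\<^sup>2) + c * ((r t)\<^sup>2 / k)"
        using pos by (simp add: Y_def field_simps)
      also have "\<dots> \<le> d * (d * (\<omega> t)\<^sup>2 / 2) + k * (2 * k * (p t)\<^sup>2) + k * ((r t)\<^sup>2 / k)"
        using pos c by (intro add_mono mult_right_mono) auto
      also have "\<dots> = d * (d / 2) * (\<omega> t)\<^sup>2 + 2 * k\<^sup>2 * (p t)\<^sup>2 + (r t)\<^sup>2"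
        using pos by (simp add: power2_eq_square)
      finally show ?thesis by simp
    qed
    finally have "d * Y' t \<le> d * (- c * Y t)" by (simp add: algebra_simps)
    then show ?thesis using pos by (simp only: mult_le_cancel_left_pos)
  qed
  have nn: "Y t \<ge> 0" for t using pos by (simp add: Y_def)
  have lim: "(Y \<longlongrightarrow> 0) at_top" by (rule exponential_decay[OF Y c(1) le nn])
  have dom: "(x \<longlongrightarrow> 0) at_top" if "\<And>t. K * (x t)\<^sup>2 \<le> Y t" "K > 0" for x :: "real \<Rightarrow> real" and K
  proof -
    have "((\<lambda>t. K * (x t)\<^sup>2) \<longlongrightarrow> 0) at_top"
      by (rule tendsto_sandwich[OF _ _ tendsto_const lim]) (use that in auto)
    then have "((\<lambda>t. (K * (x t)\<^sup>2) / K) \<longlongrightarrow> 0 / K) at_top"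
      using that by (intro tendsto_divide tendsto_const) auto
    then have "((\<lambda>t. (x t)\<^sup>2) \<longlongrightarrow> 0) at_top" using that by simp
    then show ?thesis using tendsto_real_sqrt[of "\<lambda>t. (x t)\<^sup>2" 0]
      by (simp add: tendsto_rabs_zero_iff)
  qed
  show "(\<omega> \<longlongrightarrow> 0) at_top"
    by (rule dom[of "m / 2"]) (use pos in \<open>auto simp: Y_def\<close>)
  show p: "(p \<longlongrightarrow> 0) at_top"
    by (rule dom[of "2 * k / d"]) (use pos in \<open>auto simp: Y_def\<close>)
  have r: "(r \<longlongrightarrow> 0) at_top"
    by (rule dom[of "1 / (k * d)"]) (use pos in \<open>auto simp: Y_def\<close>)
  show "(u \<longlongrightarrow> 0) at_top"
    using tendsto_diff[OF r tendsto_mult_right_zero[OF p, of "2 * k"]] by (simp add: r_def)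
qed

lemma average_mode_integrals:
  fixes \<omega> p u :: "real \<Rightarrow> real"
  assumes pos: "m > 0" "d > 0" "k > 0"
    and \<omega>': "\<And>t. (\<omega> has_real_derivative (- d * \<omega> t + u t) / m) (at t)"
    and p': "\<And>t. (p has_real_derivative u t) (at t)"
    and u': "\<And>t. (u has_real_derivative - 4 * k\<^sup>2 * p t - 4 * k * u t) (at t)"
    and init: "\<omega> 0 = 1 / m" "p 0 = 1" "u 0 = 0"
  shows "(\<integral>\<^sup>+ t \<in> {0..}. ennreal ((\<omega> t)\<^sup>2) \<partial>lborel)
      = ennreal ((d + 5 * m * k) / (2 * m * (2 * k * m + d)\<^sup>2))"
    and "(\<integral>\<^sup>+ t \<in> {0..}. ennreal ((u t)\<^sup>2) \<partial>lborel) = ennreal (k / 2)"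
proof -
  note lim = average_mode_decay[OF pos \<omega>' p' u']
  have cont: "continuous_on UNIV \<omega>" "continuous_on UNIV u"
    using \<omega>' u' by (auto intro!: continuous_at_imp_continuous_on intro: DERIV_isCont)
  define D where "D = 2 * k * m + d"
  have D: "D > 0" using pos by (simp add: D_def add_pos_pos)
  \<comment> \<open>The coefficients of the quadratic form \<open>V\<close> solve the linear system \<open>e1\<close> to \<open>e5\<close> below,
    which expresses \<open>V' = - \<omega>\<^sup>2\<close>.\<close>
  define x1 x2 x3 x4 x5 where "x1 = m / (2 * d)" and "x2 = - 4 * k\<^sup>2 * m\<^sup>2 / (d * D\<^sup>2)"
    and "x3 = m / D\<^sup>2" and "x4 = (k + 4 * k\<^sup>2 * m / d) / (2 * D\<^sup>2)" and "x5 = 1 / (8 * k * D\<^sup>2)"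
  note x_defs = x1_def x2_def x3_def x4_def x5_def
  \<comment> \<open>A monomial \<open>p * u\<close> would be the only one to produce
    \<open>(p t)\<^sup>2\<close> in the derivative, so its coefficient must be zero and five
    coefficients remain.\<close>
  define V where "V t = x1 * (\<omega> t)\<^sup>2 + x2 * (\<omega> t * p t) + x3 * (\<omega> t * u t)
      + x4 * (p t)\<^sup>2 + x5 * (u t)\<^sup>2" for t
  have e1: "2 * x1 * (d / m) - 1 = 0"
    and e2: "x2 * (d / m) + 4 * k\<^sup>2 * x3 = 0"
    and e4: "x2 / m + 2 * x4 - 8 * k\<^sup>2 * x5 = 0"
    and e5: "x3 / m - 8 * k * x5 = 0"
    using pos D by (simp_all add: x_defs divide_simps) (simp_all add: power2_eq_square algebra_simps)
  have e3: "2 * x1 / m + x2 - 4 * k * x3 - x3 * (d / m) = 0"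
  proof -
    have "2 * x1 / m + x2 - 4 * k * x3 - x3 * (d / m)
        = (D\<^sup>2 - 4 * k\<^sup>2 * m\<^sup>2 - 4 * k * m * d - d\<^sup>2) / (d * D\<^sup>2)"
      using pos D by (simp add: x_defs divide_simps) (simp add: power2_eq_square algebra_simps)
    also have "D\<^sup>2 - 4 * k\<^sup>2 * m\<^sup>2 - 4 * k * m * d - d\<^sup>2 = 0"
      by (simp add: D_def power2_eq_square algebra_simps)
    finally show ?thesis by simp
  qed
  have V: "(V has_real_derivative - ((\<omega> t)\<^sup>2)) (at t)" for t
  proof -
    define w where "w = (- d * \<omega> t + u t) / m"
    have w: "(\<omega> has_real_derivative w) (at t)" unfolding w_def by (rule \<omega>')
    have "(V has_real_derivative x1 * (2 * \<omega> t * w) + x2 * (w * p t + \<omega> t * u t)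
        + x3 * (w * u t + \<omega> t * (- 4 * k\<^sup>2 * p t - 4 * k * u t))
        + x4 * (2 * p t * u t) + x5 * (2 * u t * (- 4 * k\<^sup>2 * p t - 4 * k * u t))) (at t)"
      (is "(_ has_real_derivative ?V') _")
      unfolding V_def[abs_def]
      by (auto intro!: derivative_eq_intros w p' u' simp: algebra_simps)
    moreover have "?V' = - ((\<omega> t)\<^sup>2) - (2 * x1 * (d / m) - 1) * (\<omega> t)\<^sup>2
        - (x2 * (d / m) + 4 * k\<^sup>2 * x3) * (\<omega> t * p t)
        + (2 * x1 / m + x2 - 4 * k * x3 - x3 * (d / m)) * (\<omega> t * u t)
        + (x2 / m + 2 * x4 - 8 * k\<^sup>2 * x5) * (p t * u t) + (x3 / m - 8 * k * x5) * (u t)\<^sup>2"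
      by (simp add: w_def power2_eq_square add_divide_distrib diff_divide_distrib algebra_simps)
    ultimately show ?thesis by (simp only: e1 e2 e3 e4 e5) simp
  qed
  have "(V \<longlongrightarrow> x1 * 0\<^sup>2 + x2 * (0 * 0) + x3 * (0 * 0) + x4 * 0\<^sup>2 + x5 * 0\<^sup>2) at_top"
    unfolding V_def[abs_def] by (intro tendsto_intros lim)
  then have "(V \<longlongrightarrow> 0) at_top" by simp
  from nn_integral_dissipation[OF V _ _ this]
  have "(\<integral>\<^sup>+ t \<in> {0..}. ennreal ((\<omega> t)\<^sup>2) \<partial>lborel) = ennreal (V 0)"
    using cont by (simp add: continuous_intros)
  also have "V 0 = (d + 5 * m * k) / (2 * m * D\<^sup>2)"
  proof -
    have "V 0 * (2 * m * d * D\<^sup>2) = D\<^sup>2 - 4 * k\<^sup>2 * m\<^sup>2 + k * m * d"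
      using pos D by (simp add: V_def x_defs init divide_simps) (simp add: eval_nat_numeral algebra_simps)
    also have "\<dots> = (d + 5 * m * k) * d" by (simp add: D_def algebra_simps power2_eq_square)
    finally have "V 0 * (2 * m * D\<^sup>2) * d = (d + 5 * m * k) * d" by (simp add: mult_ac)
    then have "V 0 * (2 * m * D\<^sup>2) = d + 5 * m * k" using pos by simp
    then show ?thesis using pos D by (subst nonzero_eq_divide_eq) auto
  qed
  finally show "(\<integral>\<^sup>+ t \<in> {0..}. ennreal ((\<omega> t)\<^sup>2) \<partial>lborel)
      = ennreal ((d + 5 * m * k) / (2 * m * (2 * k * m + d)\<^sup>2))" by (simp add: D_def)
  \<comment> \<open>The weights make the mixed terms \<open>p * u\<close> cancel in the
    derivative.\<close>
  define U where "U t = k / 2 * (p t)\<^sup>2 + (u t)\<^sup>2 / (8 * k)" for t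
  have U: "(U has_real_derivative - ((u t)\<^sup>2)) (at t)" for t
    unfolding U_def[abs_def] using pos
    by (auto intro!: derivative_eq_intros p' u' simp: field_simps power2_eq_square)
  have "(U \<longlongrightarrow> k / 2 * 0\<^sup>2 + 0\<^sup>2 / (8 * k)) at_top"
    unfolding U_def[abs_def] using pos by (intro tendsto_intros lim) auto
  then have "(U \<longlongrightarrow> 0) at_top" by simp
  from nn_integral_dissipation[OF U _ _ this]
  show "(\<integral>\<^sup>+ t \<in> {0..}. ennreal ((u t)\<^sup>2) \<partial>lborel) = ennreal (k / 2)"
    using cont by (simp add: continuous_intros U_def init)
qed

section \<open>The oscillating modes\<close>

text \<open>The energy dissipates only \<omega>. The cross term
  \<open>e * m * \<omega> * \<theta>\<close> adds dissipation in \<theta>, and a small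
  \<open>e\<close> keeps it below half the energy; both parts are Young inequalities. The stiffness
  \<open>s\<close> may differ from \<open>l\<close> because the control reduces it to
  \<open>l - l / q\<^sup>2\<close>.\<close>

lemma oscillator_energy_bounds:
  fixes \<theta> \<omega> :: real
  assumes pos: "m > 0" "d > 0" "l > 0" "e > 0" and e: "e * m \<le> d / 4" "e * d \<le> l / 8"
    and s: "l / 2 \<le> s"
  shows "\<bar>e * m * \<omega> * \<theta>\<bar> \<le> (m * \<omega>\<^sup>2 / 2 + s * \<theta>\<^sup>2 / 2) / 2"
    and "- (d - e * m) * \<omega>\<^sup>2 - e * s * \<theta>\<^sup>2 - e * d * \<omega> * \<theta> \<le> - (d / 2) * \<omega>\<^sup>2 - (e * l / 4) * \<theta>\<^sup>2"
proof -
  have "e * e * m \<le> e * d / 4" using mult_left_mono[OF e(1), of e] pos by (simp add: mult_ac)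
  then have "e * e * m \<le> s / 4" using e(2) s pos(3) by linarith
  then have "e * e * m * \<theta>\<^sup>2 \<le> s / 4 * \<theta>\<^sup>2" by (intro mult_right_mono) auto
  moreover have "2 * \<bar>e * m * \<omega> * \<theta>\<bar> \<le> m * \<omega>\<^sup>2 / 2 + 2 * (e * e * m * \<theta>\<^sup>2)"
  proof -
    have "0 \<le> m / 2 * (\<bar>\<omega>\<bar> - 2 * e * \<bar>\<theta>\<bar>)\<^sup>2" using pos by simp
    also have "\<dots> = m * \<omega>\<^sup>2 / 2 + 2 * (e * e * m * \<theta>\<^sup>2) - 2 * (e * m * (\<bar>\<omega>\<bar> * \<bar>\<theta>\<bar>))"
      by (simp add: power2_diff power_mult_distrib) (simp add: algebra_simps power2_eq_square)
    finally have "2 * (e * m * (\<bar>\<omega>\<bar> * \<bar>\<theta>\<bar>)) \<le> m * \<omega>\<^sup>2 / 2 + 2 * (e * e * m * \<theta>\<^sup>2)" by simp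
    moreover have "\<bar>e * m * \<omega> * \<theta>\<bar> = e * m * (\<bar>\<omega>\<bar> * \<bar>\<theta>\<bar>)" using pos by (simp add: abs_mult)
    ultimately show ?thesis by simp
  qed
  ultimately show "\<bar>e * m * \<omega> * \<theta>\<bar> \<le> (m * \<omega>\<^sup>2 / 2 + s * \<theta>\<^sup>2 / 2) / 2" by simp
  have "e * m * \<omega>\<^sup>2 \<le> d / 4 * \<omega>\<^sup>2" using e(1) by (intro mult_right_mono) auto
  moreover have "e * (l / 2) * \<theta>\<^sup>2 \<le> e * s * \<theta>\<^sup>2" using s pos by (intro mult_right_mono mult_left_mono) auto
  moreover have "- (e * d * \<omega> * \<theta>) \<le> d / 4 * \<omega>\<^sup>2 + e * l / 4 * \<theta>\<^sup>2"
  proof -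
    have "e * e * d \<le> e * (l / 4)" using mult_left_mono[OF e(2), of e] mult_pos_pos[OF pos(4,3)] pos by (simp add: mult_ac)
    then have "e * e * d * \<theta>\<^sup>2 \<le> e * (l / 4) * \<theta>\<^sup>2" by (intro mult_right_mono) auto
    moreover have "0 \<le> d / 4 * (\<omega> + 2 * e * \<theta>)\<^sup>2" using pos by simp
    ultimately show ?thesis by (simp add: power2_sum power_mult_distrib algebra_simps power2_eq_square)
  qed
  ultimately show "- (d - e * m) * \<omega>\<^sup>2 - e * s * \<theta>\<^sup>2 - e * d * \<omega> * \<theta> \<le> - (d / 2) * \<omega>\<^sup>2 - (e * l / 4) * \<theta>\<^sup>2"
    by (simp add: algebra_simps)
qed

lemma oscillator_cross_weight:
  assumes "m > 0" "d > 0" "l > (0::real)"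
  obtains e where "e > 0" "e * m \<le> d / 4" "e * d \<le> l / 8"
proof
  let ?e = "min (d / (4 * m)) (l / (8 * d))"
  show "?e > 0" using assms by simp
  have "?e * m \<le> d / (4 * m) * m" "?e * d \<le> l / (8 * d) * d"
    using assms by (intro mult_right_mono; simp)+
  then show "?e * m \<le> d / 4" "?e * d \<le> l / 8" using assms by simp_all
qed

text \<open>The value comes from the balance of \<open>F\<close>, but
  \<open>F' = - d * (\<omega> t)\<^sup>2\<close> vanishes where \<omega> does and gives no decay
  rate. \<open>Z\<close>, comparable to \<open>F\<close>, is there only to show that
  \<open>F\<close> tends to zero.\<close>

lemma damped_oscillator_integral:
  fixes \<theta> \<omega> :: "real \<Rightarrow> real"
  assumes pos: "m > 0" "d > 0" "l > 0"
    and \<theta>': "\<And>t. (\<theta> has_real_derivative \<omega> t) (at t)"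
    and \<omega>': "\<And>t. (\<omega> has_real_derivative (- l * \<theta> t - d * \<omega> t) / m) (at t)"
    and init: "\<theta> 0 = 0" "\<omega> 0 = 1 / m"
  shows "(\<integral>\<^sup>+ t \<in> {0..}. ennreal ((\<omega> t)\<^sup>2) \<partial>lborel) = ennreal (1 / (2 * m * d))"
proof -
  obtain e where e: "e > 0" "e * m \<le> d / 4" "e * d \<le> l / 8"
    using oscillator_cross_weight[OF pos] .
  note bounds = oscillator_energy_bounds[OF pos e, of l]
  define F where "F t = m * (\<omega> t)\<^sup>2 / 2 + l * (\<theta> t)\<^sup>2 / 2" for t
  define Z where "Z t = F t + e * m * \<omega> t * \<theta> t" for t
  define Z' where "Z' t = - (d - e * m) * (\<omega> t)\<^sup>2 - e * l * (\<theta> t)\<^sup>2 - e * d * \<omega> t * \<theta> t" for t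
  have F: "(F has_real_derivative - d * (\<omega> t)\<^sup>2) (at t)" for t
    unfolding F_def[abs_def] using pos
    by (auto intro!: derivative_eq_intros \<theta>' \<omega>' simp: field_simps power2_eq_square)
  have Z: "(Z has_real_derivative Z' t) (at t)" for t
    unfolding Z_def[abs_def] Z'_def using pos
    by (auto intro!: derivative_eq_intros \<theta>' \<omega>' F simp: field_simps power2_eq_square)
  have FZ: "F t \<le> 2 * Z t" "Z t \<le> 2 * F t" for t
    using bounds(1)[of "\<omega> t" "\<theta> t"] pos by (simp_all add: F_def Z_def abs_le_iff)
  have F0: "0 \<le> F t" for t using pos by (simp add: F_def)
  define c where "c = min (d / (2 * m)) (e / 4)"
  have c: "c > 0" using pos e by (simp add: c_def)
  have cc: "c * m \<le> d / 2" "c * l \<le> e * l / 4"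
  proof -
    have "c * m \<le> d / (2 * m) * m" "c * l \<le> e / 4 * l"
      unfolding c_def using pos by (intro mult_right_mono; simp)+
    then show "c * m \<le> d / 2" "c * l \<le> e * l / 4" using pos by simp_all
  qed
  have "Z' t \<le> - c * Z t" for t
  proof -
    have "Z' t \<le> - (d / 2 * (\<omega> t)\<^sup>2) - (e * l / 4) * (\<theta> t)\<^sup>2"
      using bounds(2)[of "\<omega> t" "\<theta> t"] pos by (simp add: Z'_def)
    also have "\<dots> \<le> - (c * m * (\<omega> t)\<^sup>2) - (c * l) * (\<theta> t)\<^sup>2"
      using mult_right_mono[OF cc(1), of "(\<omega> t)\<^sup>2"] mult_right_mono[OF cc(2), of "(\<theta> t)\<^sup>2"] by simp
    also have "\<dots> = - (c * (2 * F t))" by (simp add: F_def field_simps)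
    also have "\<dots> \<le> - (c * Z t)" using FZ(2)[of t] c by simp
    finally show ?thesis by simp
  qed
  moreover have "Z t \<ge> 0" for t using FZ(1)[of t] F0[of t] by simp
  ultimately have "(Z \<longlongrightarrow> 0) at_top" by (rule exponential_decay[OF Z c])
  from tendsto_mult_right_zero[OF this, of 2] have "(F \<longlongrightarrow> 0) at_top"
    using FZ F0 by (intro tendsto_sandwich[OF _ _ tendsto_const, of 0 F _ "\<lambda>t. 2 * Z t"]) auto
  then have "((\<lambda>t. F t / d) \<longlongrightarrow> 0) at_top" by (rule tendsto_divide_zero)
  moreover have "((\<lambda>t. F t / d) has_real_derivative - ((\<omega> t)\<^sup>2)) (at t)" for t
    using DERIV_cdivide[OF F[of t], of d] pos by simp
  moreover have "continuous_on UNIV \<omega>"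
    using \<omega>' by (auto intro!: continuous_at_imp_continuous_on intro: DERIV_isCont)
  ultimately have "(\<integral>\<^sup>+ t \<in> {0..}. ennreal ((\<omega> t)\<^sup>2) \<partial>lborel) = ennreal (F 0 / d)"
    by (intro nn_integral_dissipation continuous_intros) auto
  also have "F 0 / d = 1 / (2 * m * d)"
    using pos by (simp add: F_def init field_simps power2_eq_square)
  finally show ?thesis .
qed

section \<open>The oscillator coupled to the fast control loop\<close>

text \<open>The left-hand side is the derivative of the Lyapunov function \<open>Z\<close> of the next lemma. In the
  variable \<open>\<beta> = q b\<close> every term mixing \<open>\<beta>\<close> or \<open>a\<close> with another variable carries a factor \<open>1 / q\<close>,
  so the diagonal terms dominate once \<open>q\<close> is large, with a rate \<open>c\<close> that does not depend on \<open>q\<close>.\<close>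

lemma controlled_oscillator_dissipation:
  fixes \<theta> \<omega> a b :: real
  assumes pos: "m > 0" "d > 0" "k > 0" "l > 0" and e: "e > 0" "e * m \<le> d / 4" "e * d \<le> l / 8"
    and q: "q \<ge> 2" and s: "s = l - l / q\<^sup>2"
    and c: "2 * c \<le> d / 2" "2 * c \<le> e * l / 4" "2 * c \<le> 2 * k" "2 * c \<le> 1 / (2 * k)"
    and M: "e + 2 + l / k + (1 + l / k\<^sup>2) \<le> c * q"
  shows "- (d - e * m) * \<omega>\<^sup>2 - e * s * \<theta>\<^sup>2 - e * d * \<omega> * \<theta> - 2 * k * a\<^sup>2 - q\<^sup>2 / (2 * k) * b\<^sup>2
      + e * b * \<theta> - 2 * a * b + l / (2 * k * q\<^sup>2) * a * \<omega>
      + (1 - l / (4 * k\<^sup>2) + l / (2 * k\<^sup>2 * q\<^sup>2)) * b * \<omega>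
    \<le> - c * (\<omega>\<^sup>2 + \<theta>\<^sup>2 + a\<^sup>2 + q\<^sup>2 * b\<^sup>2)" (is "?l \<le> - c * ?N")
proof -
  have q2: "q\<^sup>2 \<ge> 2" using q power_mono[of 2 q 2] by simp
  then have "l / q\<^sup>2 \<le> l / 2" using pos by (intro divide_left_mono) auto
  then have s2: "l / 2 \<le> s" by (simp add: s)
  define \<beta> where "\<beta> = q * b"
  have b: "b = \<beta> / q" using q by (simp add: \<beta>_def)
  define N where "N = \<omega>\<^sup>2 + \<theta>\<^sup>2 + a\<^sup>2 + \<beta>\<^sup>2"
  have N0: "N \<ge> 0" by (simp add: N_def)
  have pr: "\<bar>x * y\<bar> \<le> N" if "x\<^sup>2 + y\<^sup>2 \<le> N" for x y
  proof -
    have "2 * \<bar>x * y\<bar> \<le> x\<^sup>2 + y\<^sup>2"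
      using sum_squares_bound[of "\<bar>x\<bar>" "\<bar>y\<bar>"] by (simp add: abs_mult)
    then show ?thesis using that by linarith
  qed
  have err: "r * (x * y) \<le> R / q * N" if "\<bar>r\<bar> \<le> R / q" "x\<^sup>2 + y\<^sup>2 \<le> N" for r R x y
  proof -
    have "r * (x * y) \<le> \<bar>r\<bar> * \<bar>x * y\<bar>" by (metis abs_ge_self abs_mult)
    also have "\<dots> \<le> R / q * N" using that pr[OF that(2)] by (intro mult_mono) auto
    finally show ?thesis .
  qed
  have qq: "1 / q\<^sup>2 \<le> 1 / q" using q by (intro divide_left_mono) (auto simp: power2_eq_square)
  have E1: "e / q * (\<beta> * \<theta>) \<le> e / q * N"
    by (rule err) (use q e in \<open>auto simp: N_def\<close>)
  have E2: "- 2 / q * (a * \<beta>) \<le> 2 / q * N"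
    by (rule err) (use q in \<open>auto simp: N_def\<close>)
  have E3: "l / (2 * k * q\<^sup>2) * (a * \<omega>) \<le> (l / k) / q * N"
  proof (rule err)
    have "l / (2 * k * q\<^sup>2) = l / (2 * k) * (1 / q\<^sup>2)" by simp
    also have "\<dots> \<le> l / k * (1 / q)" using pos q
      by (intro mult_mono[OF divide_left_mono qq]) auto
    finally show "\<bar>l / (2 * k * q\<^sup>2)\<bar> \<le> l / k / q" using pos by simp
  qed (auto simp: N_def)
  have E4: "(1 - l / (4 * k\<^sup>2) + l / (2 * k\<^sup>2 * q\<^sup>2)) / q * (\<beta> * \<omega>) \<le> (1 + l / k\<^sup>2) / q * N"
  proof (rule err)
    have "1 / q\<^sup>2 \<le> 1 / 1" using q2 by (intro divide_left_mono) auto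
    then have "l / (2 * k\<^sup>2) * (1 / q\<^sup>2) \<le> l / (2 * k\<^sup>2) * 1"
      using pos by (intro mult_left_mono) auto
    then have "l / (2 * k\<^sup>2 * q\<^sup>2) \<le> l / k\<^sup>2 / 2" by (simp add: mult.commute)
    moreover have "0 \<le> l / (2 * k\<^sup>2 * q\<^sup>2)" "0 \<le> l / k\<^sup>2" using pos by simp_all
    moreover have "\<bar>1 - x / 4 + y\<bar> \<le> 1 + x" if "y \<le> x / 2" "0 \<le> y" "0 \<le> x" for x y :: real
      using that by (auto simp: abs_le_iff)
    ultimately have "\<bar>1 - l / k\<^sup>2 / 4 + l / (2 * k\<^sup>2 * q\<^sup>2)\<bar> \<le> 1 + l / k\<^sup>2" by blast
    then have "\<bar>1 - l / (4 * k\<^sup>2) + l / (2 * k\<^sup>2 * q\<^sup>2)\<bar> \<le> 1 + l / k\<^sup>2" by (simp add: mult.commute)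
    then show "\<bar>(1 - l / (4 * k\<^sup>2) + l / (2 * k\<^sup>2 * q\<^sup>2)) / q\<bar> \<le> (1 + l / k\<^sup>2) / q"
      using q by (simp add: divide_right_mono)
  qed (auto simp: N_def)
  \<comment> \<open>The diagonal terms provide the rate \<open>2 * c\<close>. The four mixed terms
    are each a constant times \<open>N / q\<close>, and hypothesis \<open>M\<close> makes their
    total at most \<open>c * N\<close>, so that the rate \<open>c\<close> survives.\<close>
  have sum: "e / q * N + 2 / q * N + (l / k) / q * N + (1 + l / k\<^sup>2) / q * N \<le> c * N"
  proof -
    have "(e + 2 + l / k + (1 + l / k\<^sup>2)) / q \<le> c" using M q by (simp add: pos_divide_le_eq)
    from mult_right_mono[OF this N0] show ?thesis by (simp add: add_divide_distrib algebra_simps)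
  qed
  have "2 * c * N \<le> d / 2 * \<omega>\<^sup>2 + e * l / 4 * \<theta>\<^sup>2 + 2 * k * a\<^sup>2 + 1 / (2 * k) * \<beta>\<^sup>2"
    unfolding N_def distrib_left using c by (intro add_mono mult_right_mono) auto
  moreover have "?l = (- (d - e * m) * \<omega>\<^sup>2 - e * s * \<theta>\<^sup>2 - e * d * \<omega> * \<theta>) - 2 * k * a\<^sup>2 - 1 / (2 * k) * \<beta>\<^sup>2
      + e / q * (\<beta> * \<theta>) + (- 2 / q * (a * \<beta>)) + l / (2 * k * q\<^sup>2) * (a * \<omega>)
      + (1 - l / (4 * k\<^sup>2) + l / (2 * k\<^sup>2 * q\<^sup>2)) / q * (\<beta> * \<omega>)"
    unfolding b using q by (simp add: power_divide)
  moreover have "?N = N" by (simp add: N_def \<beta>_def power_mult_distrib)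
  ultimately show ?thesis
    using E1 E2 E3 E4 sum oscillator_energy_bounds(2)[OF pos(1,2,4) e s2, of \<omega> \<theta>] by simp
qed

text \<open>\<open>a\<close> and \<open>b\<close> are deviations from the equilibrium for frozen
  \<theta>, so \<open>b + l / q\<^sup>2 * \<theta>\<close> is the control input. The energy balance
  is disturbed only by \<open>b * \<omega>\<close>, which is of order 1 / q because the dissipated
  quantity \<open>N\<close> contains \<open>q\<^sup>2 * b\<^sup>2\<close>.\<close>

lemma controlled_oscillator_integrals:
  fixes \<theta> \<omega> a b :: "real \<Rightarrow> real"
  assumes pos: "m > 0" "d > 0" "k > 0" "l > 0" and e: "e > 0" "e * m \<le> d / 4" "e * d \<le> l / 8"
    and q: "q \<ge> 2"
    and c: "c > 0" "2 * c \<le> d / 2" "2 * c \<le> e * l / 4" "2 * c \<le> 2 * k" "2 * c \<le> 1 / (2 * k)"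
    and M: "e + 2 + l / k + (1 + l / k\<^sup>2) \<le> c * q"
    and \<theta>': "\<And>t. (\<theta> has_real_derivative \<omega> t) (at t)"
    and \<omega>': "\<And>t. (\<omega> has_real_derivative (- (l - l / q\<^sup>2) * \<theta> t - d * \<omega> t + b t) / m) (at t)"
    and a': "\<And>t. (a has_real_derivative q\<^sup>2 * b t + l / q\<^sup>2 / k * \<omega> t) (at t)"
    and b': "\<And>t. (b has_real_derivative - 4 * k\<^sup>2 * a t - 4 * k * b t - l / q\<^sup>2 * \<omega> t) (at t)"
    and init: "\<theta> 0 = 0" "\<omega> 0 = 1 / m" "a 0 = 1" "b 0 = 0"
  shows "(\<integral>\<^sup>+ t \<in> {0..}. ennreal ((\<omega> t)\<^sup>2) \<partial>lborel)
      \<le> ennreal (1 / (2 * m * d) + 1 / (2 * c * d * q) * (1 / (2 * m) + 1 / 2))"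
    and "ennreal (1 / (2 * m * d) - 1 / (2 * c * d * q) * (1 / (2 * m) + 1 / 2))
      \<le> (\<integral>\<^sup>+ t \<in> {0..}. ennreal ((\<omega> t)\<^sup>2) \<partial>lborel)"
    and "(\<integral>\<^sup>+ t \<in> {0..}. ennreal ((b t + l / q\<^sup>2 * \<theta> t)\<^sup>2) \<partial>lborel)
      \<le> ennreal ((2 + 2 * l\<^sup>2) / (c * q\<^sup>2) * (1 / (2 * m) + 1 / 2))"
proof -
  define \<kappa> where "\<kappa> = l / q\<^sup>2"
  define s where "s = l - \<kappa>"
  have q2: "q\<^sup>2 \<ge> 4" using q power_mono[of 2 q 2] by simp
  have \<kappa>: "\<kappa> * q\<^sup>2 = l" "\<kappa> > 0" using q pos by (auto simp: \<kappa>_def)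
  have "l / q\<^sup>2 \<le> l / 2" using pos q2 by (intro divide_left_mono) auto
  then have s2: "l / 2 \<le> s" "s \<le> l" using \<kappa> by (auto simp: s_def \<kappa>_def)
  have cont: "continuous_on UNIV \<theta>" "continuous_on UNIV \<omega>" "continuous_on UNIV a" "continuous_on UNIV b"
    by (rule DERIV_continuous_on, rule has_field_derivative_at_within, rule \<theta>' \<omega>' a' b')+
  define F where "F t = m * (\<omega> t)\<^sup>2 / 2 + s * (\<theta> t)\<^sup>2 / 2" for t
  define F' where "F' t = - d * (\<omega> t)\<^sup>2 + b t * \<omega> t" for t
  \<comment> \<open>Energy of the fast pair: the weight of \<open>b\<close> is chosen to cancel the
    large terms \<open>q\<^sup>2 * a * b\<close> in the derivative.\<close>
  define W where "W t = (a t)\<^sup>2 / 2 + q\<^sup>2 * (b t)\<^sup>2 / (8 * k\<^sup>2)" for t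
  \<comment> \<open>\<open>W\<close> dissipates only \<open>b\<close>. The term
    \<open>a * b / (2 * k)\<close> plays the role that \<open>e * m * \<omega> * \<theta>\<close>
    has for \<open>F\<close>: it yields \<open>- 2 * k * a\<^sup>2\<close> at the price of half the
    dissipation of \<open>b\<close>.\<close>
  define Z where "Z t = F t + e * m * \<omega> t * \<theta> t + W t + a t * b t / (2 * k)" for t
  define Z' where "Z' t = - (d - e * m) * (\<omega> t)\<^sup>2 - e * s * (\<theta> t)\<^sup>2 - e * d * \<omega> t * \<theta> t - 2 * k * (a t)\<^sup>2
      - q\<^sup>2 / (2 * k) * (b t)\<^sup>2 + e * b t * \<theta> t - 2 * a t * b t + l / (2 * k * q\<^sup>2) * a t * \<omega> t
      + (1 - l / (4 * k\<^sup>2) + l / (2 * k\<^sup>2 * q\<^sup>2)) * b t * \<omega> t" for t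
  define N where "N t = (\<omega> t)\<^sup>2 + (\<theta> t)\<^sup>2 + (a t)\<^sup>2 + q\<^sup>2 * (b t)\<^sup>2" for t
  have w: "(\<omega> has_real_derivative (- s * \<theta> t - d * \<omega> t + b t) / m) (at t)" for t
    using \<omega>'[of t] by (simp add: s_def \<kappa>_def)
  have F: "(F has_real_derivative F' t) (at t)" for t
  proof -
    have "(F has_real_derivative \<omega> t * (m * ((- s * \<theta> t - d * \<omega> t + b t) / m)) + s * \<theta> t * \<omega> t) (at t)"
      unfolding F_def[abs_def]
      by (rule derivative_eq_intros \<theta>' w refl | simp add: power2_eq_square)+
    then have "(F has_real_derivative \<omega> t * (- s * \<theta> t - d * \<omega> t + b t) + s * \<theta> t * \<omega> t) (at t)"
      using pos by simp
    then show ?thesis by (simp add: F'_def algebra_simps power2_eq_square)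
  qed
  have W: "(W has_real_derivative \<kappa> / k * a t * \<omega> t - q\<^sup>2 / k * (b t)\<^sup>2 - l / (4 * k\<^sup>2) * b t * \<omega> t) (at t)" for t
  proof -
    have "(W has_real_derivative a t * (q\<^sup>2 * b t + \<kappa> / k * \<omega> t)
        + q\<^sup>2 / (4 * k\<^sup>2) * b t * (- 4 * k\<^sup>2 * a t - 4 * k * b t - \<kappa> * \<omega> t)) (at t)"
    proof -
      have "((\<lambda>t. 1 / 2 * (a t)\<^sup>2 + q\<^sup>2 / (8 * k\<^sup>2) * (b t)\<^sup>2) has_real_derivative
          1 / 2 * (of_nat 2 * ((q\<^sup>2 * b t + l / q\<^sup>2 / k * \<omega> t) * a t ^ (2 - Suc 0)))
          + q\<^sup>2 / (8 * k\<^sup>2) * (of_nat 2 * ((- 4 * k\<^sup>2 * a t - 4 * k * b t - l / q\<^sup>2 * \<omega> t) * b t ^ (2 - Suc 0)))) (at t)"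
        by (intro DERIV_add DERIV_cmult DERIV_power a' b')
      moreover have "1 / 2 * (of_nat 2 * (x * a t ^ (2 - Suc 0))) = a t * x"
          "q\<^sup>2 / (8 * k\<^sup>2) * (of_nat 2 * (x * b t ^ (2 - Suc 0))) = q\<^sup>2 / (4 * k\<^sup>2) * b t * x" for x
        by simp_all
      moreover have "W = (\<lambda>t. 1 / 2 * (a t)\<^sup>2 + q\<^sup>2 / (8 * k\<^sup>2) * (b t)\<^sup>2)"
        by (simp add: W_def[abs_def])
      ultimately show ?thesis by (simp only: \<kappa>_def)
    qed
    moreover have "q\<^sup>2 / (4 * k\<^sup>2) * b t * (- 4 * k\<^sup>2 * a t - 4 * k * b t - \<kappa> * \<omega> t)
        = - q\<^sup>2 * a t * b t - q\<^sup>2 / k * (b t)\<^sup>2 - (\<kappa> * q\<^sup>2) / (4 * k\<^sup>2) * b t * \<omega> t"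
    proof -
      define r where "r = q\<^sup>2 / (4 * k\<^sup>2)"
      have "r * (4 * k\<^sup>2) = q\<^sup>2" "r * (4 * k) = q\<^sup>2 / k" "r * \<kappa> = \<kappa> * q\<^sup>2 / (4 * k\<^sup>2)"
        using pos by (simp_all add: r_def power2_eq_square[of k])
      then have "- q\<^sup>2 * a t * b t - q\<^sup>2 / k * (b t)\<^sup>2 - (\<kappa> * q\<^sup>2) / (4 * k\<^sup>2) * b t * \<omega> t
        = - (r * (4 * k\<^sup>2)) * a t * b t - (r * (4 * k)) * (b t)\<^sup>2 - (r * \<kappa>) * b t * \<omega> t" by (simp only:)
      then show ?thesis unfolding r_def[symmetric] by (simp only:) (simp add: algebra_simps power2_eq_square)
    qed
    ultimately have "(W has_real_derivative a t * (q\<^sup>2 * b t + \<kappa> / k * \<omega> t)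
        + (- q\<^sup>2 * a t * b t - q\<^sup>2 / k * (b t)\<^sup>2 - l / (4 * k\<^sup>2) * b t * \<omega> t)) (at t)"
      by (simp only: \<kappa>(1))
    then show ?thesis by (simp add: algebra_simps)
  qed
  have ab: "((\<lambda>t. a t * b t) has_real_derivative q\<^sup>2 * (b t)\<^sup>2 + \<kappa> / k * b t * \<omega> t - 4 * k\<^sup>2 * (a t)\<^sup>2
      - 4 * k * a t * b t - \<kappa> * a t * \<omega> t) (at t)" for t
    by (rule DERIV_cong[OF DERIV_mult'[OF a' b']]) (simp add: \<kappa>_def algebra_simps power2_eq_square)
  have \<omega>\<theta>: "((\<lambda>t. m * (\<omega> t * \<theta> t)) has_real_derivative m * (\<omega> t)\<^sup>2 - s * (\<theta> t)\<^sup>2 - d * \<omega> t * \<theta> t + b t * \<theta> t) (at t)" for t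
    by (rule DERIV_cong[OF DERIV_cmult[OF DERIV_mult'[OF w \<theta>']]])
      (use pos in \<open>simp add: field_simps power2_eq_square\<close>)
  have Z: "(Z has_real_derivative Z' t) (at t)" for t
  proof -
    have D: "((\<lambda>t. F t + e * (m * (\<omega> t * \<theta> t)) + W t + (1 / (2 * k)) * (a t * b t)) has_real_derivative
        F' t + e * (m * (\<omega> t)\<^sup>2 - s * (\<theta> t)\<^sup>2 - d * \<omega> t * \<theta> t + b t * \<theta> t)
        + (\<kappa> / k * a t * \<omega> t - q\<^sup>2 / k * (b t)\<^sup>2 - l / (4 * k\<^sup>2) * b t * \<omega> t)
        + (1 / (2 * k)) * (q\<^sup>2 * (b t)\<^sup>2 + \<kappa> / k * b t * \<omega> t - 4 * k\<^sup>2 * (a t)\<^sup>2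
            - 4 * k * a t * b t - \<kappa> * a t * \<omega> t)) (at t)"
      by (intro DERIV_add DERIV_cmult F W ab \<omega>\<theta>)
    have eq: "(1 / (2 * k)) * (q\<^sup>2 * (b t)\<^sup>2 + \<kappa> / k * b t * \<omega> t - 4 * k\<^sup>2 * (a t)\<^sup>2
            - 4 * k * a t * b t - \<kappa> * a t * \<omega> t)
        = q\<^sup>2 / k * (b t)\<^sup>2 / 2 + \<kappa> / (2 * k\<^sup>2) * b t * \<omega> t - 2 * k * (a t)\<^sup>2 - 2 * a t * b t - \<kappa> / k * a t * \<omega> t / 2"
    proof -
      define j where "j = 1 / (2 * k)"
      have j: "q\<^sup>2 / k = 2 * (j * q\<^sup>2)" "\<kappa> / (2 * k\<^sup>2) = j * (\<kappa> / k)" "2 * k = j * (4 * k\<^sup>2)" "\<kappa> / k = 2 * (j * \<kappa>)"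
        and j2: "j * (4 * k) = 2"
        using pos by (simp_all add: j_def power2_eq_square[of k])
      have ab2: "2 * a t * b t = j * (4 * k) * (a t * b t)" unfolding j2 by simp
      show ?thesis unfolding j_def[symmetric]
        by (simp only: j ab2) (simp add: algebra_simps)
    qed
    have eqs: "l / (2 * k * q\<^sup>2) = \<kappa> / k / 2" "l / (2 * k\<^sup>2 * q\<^sup>2) = \<kappa> / (2 * k\<^sup>2)" "q\<^sup>2 / (2 * k) = q\<^sup>2 / k / 2"
      by (simp_all add: \<kappa>_def)
    have fn: "Z = (\<lambda>t. F t + e * (m * (\<omega> t * \<theta> t)) + W t + (1 / (2 * k)) * (a t * b t))"
      by (simp add: Z_def[abs_def] mult.assoc)
    show ?thesis
      unfolding fn by (rule DERIV_cong[OF D]) (unfold eq Z'_def eqs F'_def, simp add: algebra_simps)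
  qed
  have Z'N: "Z' t \<le> - c * N t" for t
    unfolding Z'_def N_def
    by (rule controlled_oscillator_dissipation[OF pos e q _ c(2-5) M]) (simp add: s_def \<kappa>_def)
  have osc: "\<bar>e * m * \<omega> t * \<theta> t\<bar> \<le> F t / 2" for t
    unfolding F_def by (rule oscillator_energy_bounds(1)[OF pos(1,2,4) e s2(1)])
  \<comment> \<open>Here \<open>q \<ge> 2\<close> enters: \<open>q\<^sup>2 \<ge> 4\<close> is just
    enough for the cross term to stay below half of \<open>W\<close>.\<close>
  have ctl: "\<bar>a t * b t / (2 * k)\<bar> \<le> W t / 2" for t
  proof -
    have "2 * \<bar>a t\<bar> * \<bar>b t / k\<bar> \<le> (a t)\<^sup>2 + (b t / k)\<^sup>2"
      using sum_squares_bound[of "\<bar>a t\<bar>" "\<bar>b t / k\<bar>"] by (simp only: power2_abs)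
    moreover have "4 * (b t / k)\<^sup>2 \<le> q\<^sup>2 * (b t / k)\<^sup>2" using q2 by (intro mult_right_mono) auto
    moreover have "W t = (a t)\<^sup>2 / 2 + q\<^sup>2 * (b t / k)\<^sup>2 / 8" by (simp add: W_def power_divide)
    moreover have "\<bar>a t * b t / (2 * k)\<bar> = \<bar>a t\<bar> * \<bar>b t / k\<bar> / 2" using pos by (simp add: abs_mult)
    ultimately show ?thesis by simp
  qed
  have F0: "0 \<le> F t" "0 \<le> W t" for t using pos s2 by (simp_all add: F_def W_def)
  have FZ: "F t \<le> 2 * Z t" "Z t \<le> 2 * (F t + W t)" for t
  proof -
    have "F t \<le> 2 * (F t + y + W t + z) \<and> F t + y + W t + z \<le> 2 * (F t + W t)"
      if "\<bar>y\<bar> \<le> F t / 2" "\<bar>z\<bar> \<le> W t / 2" for y z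
      using abs_le_D1[OF that(1)] abs_le_D2[OF that(1)] abs_le_D1[OF that(2)] abs_le_D2[OF that(2)] F0[of t]
      by simp
    from this[OF osc ctl] show "F t \<le> 2 * Z t" "Z t \<le> 2 * (F t + W t)" by (simp_all only: Z_def)
  qed
  \<comment> \<open>A crude bound for the coefficients of \<open>F + W\<close> against
    \<open>N\<close>. It enters only the rate \<open>c / (2 * C)\<close>, which serves to show that
    \<open>Z\<close> tends to zero, and not the final estimates.\<close>
  define C where "C = m + l + 1 + 1 / k\<^sup>2"
  have C: "C > 0" "m \<le> C" "l \<le> C" "1 \<le> C" "1 / k\<^sup>2 \<le> C"
    using pos by (auto simp: C_def add_pos_pos intro!: add_nonneg_nonneg)
  have ZN: "Z t \<le> 2 * (C * N t)" for t
  proof -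
    have "m / 2 * (\<omega> t)\<^sup>2 + s / 2 * (\<theta> t)\<^sup>2 + 1 / 2 * (a t)\<^sup>2 + 1 / k\<^sup>2 / 8 * (q\<^sup>2 * (b t)\<^sup>2) \<le>
      C * (\<omega> t)\<^sup>2 + C * (\<theta> t)\<^sup>2 + C * (a t)\<^sup>2 + C * (q\<^sup>2 * (b t)\<^sup>2)"
      using C pos s2 by (intro add_mono mult_right_mono) auto
    then have "F t + W t \<le> C * N t" by (simp add: F_def W_def N_def algebra_simps)
    then have "2 * (F t + W t) \<le> 2 * (C * N t)" by simp
    with FZ(2)[of t] show ?thesis by (rule order_trans)
  qed
  have "Z' t \<le> - (c / (2 * C)) * Z t" for t
  proof -
    have "c / (2 * C) * Z t \<le> c / (2 * C) * (2 * (C * N t))"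
      using C c ZN[of t] by (intro mult_left_mono) auto
    also have "\<dots> = c * N t" using C by simp
    finally show ?thesis using Z'N[of t] by simp
  qed
  moreover have Z0: "Z t \<ge> 0" for t using FZ(1)[of t] F0(1)[of t] by simp
  ultimately have Zlim: "(Z \<longlongrightarrow> 0) at_top"
    using C c by (intro exponential_decay[OF Z, of "c / (2 * C)"]) auto
  from tendsto_mult_right_zero[OF this, of 2] have Flim: "(F \<longlongrightarrow> 0) at_top"
    using FZ F0 by (intro tendsto_sandwich[OF _ _ tendsto_const, of 0 F _ "\<lambda>t. 2 * Z t"]) auto
  \<comment> \<open>\<open>Z 0\<close> does not depend on \<open>q\<close>: the weight
    \<open>q\<^sup>2\<close> in \<open>W\<close> meets \<open>b 0 = 0\<close>.\<close>
  have init_F: "F 0 / d = 1 / (2 * m * d)" and init_Z: "Z 0 = 1 / (2 * m) + 1 / 2"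
    using pos by (simp_all add: Z_def F_def W_def init field_simps power2_eq_square)
  have contZ': "continuous_on UNIV Z'" unfolding Z'_def[abs_def] by (intro continuous_intros cont)
  \<comment> \<open>The defect is \<open>\<omega> * b / d\<close>. Pairing \<omega> with
    \<open>q * b\<close> bounds it by \<open>N / (2 * d * q)\<close>, and
    \<open>c * N \<le> - Z'\<close>.\<close>
  have "\<bar>F' t / d + (\<omega> t)\<^sup>2\<bar> \<le> 1 / (2 * c * d * q) * - Z' t" for t
  proof -
    have "2 * \<bar>\<omega> t\<bar> * \<bar>q * b t\<bar> \<le> (\<omega> t)\<^sup>2 + (q * b t)\<^sup>2"
      using sum_squares_bound[of "\<bar>\<omega> t\<bar>" "\<bar>q * b t\<bar>"] by (simp only: power2_abs)
    also have "\<dots> \<le> N t" by (simp add: N_def power_mult_distrib)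
    finally have "2 * \<bar>\<omega> t\<bar> * \<bar>q * b t\<bar> \<le> N t" .
    then have "c * (2 * \<bar>\<omega> t\<bar> * \<bar>q * b t\<bar>) \<le> c * N t" using c(1) by (intro mult_left_mono) auto
    also have "\<dots> \<le> - Z' t" using Z'N[of t] by simp
    finally have "1 / (2 * c * d * q) * (c * (2 * \<bar>\<omega> t\<bar> * \<bar>q * b t\<bar>)) \<le> 1 / (2 * c * d * q) * - Z' t"
      using c(1) pos q by (intro mult_left_mono) auto
    moreover have "1 / (2 * c * d * q) * (c * (2 * \<bar>\<omega> t\<bar> * \<bar>q * b t\<bar>)) = \<bar>\<omega> t\<bar> * \<bar>b t\<bar> / d"
      using c(1) pos q by (simp add: abs_mult)
    moreover have "F' t / d + (\<omega> t)\<^sup>2 = \<omega> t * b t / d"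
      using pos by (simp add: F'_def add_divide_distrib diff_divide_distrib)
    then have "\<bar>F' t / d + (\<omega> t)\<^sup>2\<bar> = \<bar>\<omega> t\<bar> * \<bar>b t\<bar> / d"
      using pos by (simp add: abs_mult)
    ultimately show ?thesis by (simp only:)
  qed
  note est = nn_integral_perturbed_dissipation[OF DERIV_cdivide[OF F, of d] Z _ _ _ contZ'
      tendsto_divide_zero[OF Flim] Zlim _ _ this, unfolded init_F init_Z]
  have cF': "continuous_on UNIV (\<lambda>t. F' t / d)"
    unfolding F'_def[abs_def] using pos by (intro continuous_intros cont) auto
  show "(\<integral>\<^sup>+ t \<in> {0..}. ennreal ((\<omega> t)\<^sup>2) \<partial>lborel)
      \<le> ennreal (1 / (2 * m * d) + 1 / (2 * c * d * q) * (1 / (2 * m) + 1 / 2))"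
    by (rule est(1)) (use c pos q in \<open>auto intro!: continuous_intros cont cF' add_nonneg_nonneg\<close>)
  show "ennreal (1 / (2 * m * d) - 1 / (2 * c * d * q) * (1 / (2 * m) + 1 / 2))
      \<le> (\<integral>\<^sup>+ t \<in> {0..}. ennreal ((\<omega> t)\<^sup>2) \<partial>lborel)"
    by (rule est(2)) (use c pos q in \<open>auto intro!: continuous_intros cont cF' add_nonneg_nonneg\<close>)
  \<comment> \<open>In \<open>N\<close> the square of \<open>b\<close> carries
    \<open>q\<^sup>2\<close>, and the equilibrium part has the even smaller factor 1 / q^4. So the
    squared control is at most \<open>(2 + 2 * l\<^sup>2) / q\<^sup>2 * N\<close>, where again
    \<open>c * N \<le> - Z'\<close>.\<close>
  define R where "R = (2 + 2 * l\<^sup>2) / (c * q\<^sup>2)"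
  have R: "R > 0" using c q pos unfolding R_def by (intro divide_pos_pos mult_pos_pos add_pos_pos) auto
  have le: "(b t + l / q\<^sup>2 * \<theta> t)\<^sup>2 \<le> R * - Z' t" for t
  proof -
    have "(b t + l / q\<^sup>2 * \<theta> t)\<^sup>2 \<le> 2 * (b t)\<^sup>2 + 2 * (l / q\<^sup>2 * \<theta> t)\<^sup>2"
      using sum_squares_bound[of "b t" "l / q\<^sup>2 * \<theta> t"] by (simp add: power2_sum)
    also have "\<dots> \<le> (2 + 2 * l\<^sup>2) / q\<^sup>2 * (q\<^sup>2 * (b t)\<^sup>2) + (2 + 2 * l\<^sup>2) / q\<^sup>2 * (\<theta> t)\<^sup>2"
    proof (rule add_mono)
      have "(2 + 2 * l\<^sup>2) / q\<^sup>2 * (q\<^sup>2 * (b t)\<^sup>2) = (2 + 2 * l\<^sup>2) * (b t)\<^sup>2" using q by simp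
      then show "2 * (b t)\<^sup>2 \<le> (2 + 2 * l\<^sup>2) / q\<^sup>2 * (q\<^sup>2 * (b t)\<^sup>2)" by (simp add: distrib_right)
      have "2 * (l / q\<^sup>2)\<^sup>2 = 2 * l\<^sup>2 / q\<^sup>2 * (1 / q\<^sup>2)" by (simp add: power2_eq_square)
      also have "\<dots> \<le> (2 + 2 * l\<^sup>2) / q\<^sup>2 * 1"
      proof (intro mult_mono divide_right_mono)
        have "1 / q\<^sup>2 \<le> 1 / 1" using q2 by (intro divide_left_mono) auto
        then show "1 / q\<^sup>2 \<le> 1" by simp
      qed auto
      finally have "2 * (l / q\<^sup>2)\<^sup>2 \<le> (2 + 2 * l\<^sup>2) / q\<^sup>2" by simp
      from mult_right_mono[OF this zero_le_power2[of "\<theta> t"]]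
      show "2 * (l / q\<^sup>2 * \<theta> t)\<^sup>2 \<le> (2 + 2 * l\<^sup>2) / q\<^sup>2 * (\<theta> t)\<^sup>2" by (simp only: power_mult_distrib mult.assoc)
    qed
    also have "\<dots> \<le> (2 + 2 * l\<^sup>2) / q\<^sup>2 * N t"
      unfolding distrib_left[symmetric] by (intro mult_left_mono) (auto simp: N_def)
    also have "\<dots> = R * (c * N t)" using c by (simp add: R_def)
    also have "\<dots> \<le> R * - Z' t" using Z'N[of t] R by (intro mult_left_mono) auto
    finally show ?thesis .
  qed
  have "(\<integral>\<^sup>+ t \<in> {0..}. ennreal ((b t + l / q\<^sup>2 * \<theta> t)\<^sup>2) \<partial>lborel)
      \<le> (\<integral>\<^sup>+ t \<in> {0..}. ennreal (R * - Z' t) \<partial>lborel)"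
    by (intro nn_integral_mono mult_right_mono ennreal_leI le) auto
  also have "\<dots> = ennreal (R * Z 0)"
  proof (rule nn_integral_dissipation)
    show "((\<lambda>t. R * Z t) has_real_derivative - (R * - Z' t)) (at t)" for t
      using DERIV_cmult[OF Z[of t], of R] by simp
    show "0 \<le> R * - Z' t" for t using order_trans[OF zero_le_power2 le] .
    show "((\<lambda>t. R * Z t) \<longlongrightarrow> 0) at_top" by (rule tendsto_mult_right_zero[OF Zlim])
  qed (intro continuous_intros contZ')
  finally show "(\<integral>\<^sup>+ t \<in> {0..}. ennreal ((b t + l / q\<^sup>2 * \<theta> t)\<^sup>2) \<partial>lborel)
      \<le> ennreal ((2 + 2 * l\<^sup>2) / (c * q\<^sup>2) * (1 / (2 * m) + 1 / 2))"
    by (simp only: R_def init_Z)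
qed

section \<open>Change of variables in the modal equations\<close>

text \<open>In \<open>p = m * \<omega> + \<eta>\<close> the damping terms cancel, so
  \<open>p' = u\<close> with \<open>u = 4 * k * \<xi>\<close>, and the control part becomes
  autonomous.\<close>

lemma average_mode_norms:
  fixes \<omega> \<eta> \<xi> :: "real \<Rightarrow> real"
  assumes pos: "m > 0" "d > 0" "k > 0"
    and \<omega>': "\<And>t. (\<omega> has_real_derivative (- d * \<omega> t + 4 * k * \<xi> t) / m) (at t)"
    and \<eta>': "\<And>t. (\<eta> has_real_derivative d * \<omega> t) (at t)"
    and \<xi>': "\<And>t. (\<xi> has_real_derivative - (k * m * \<omega> t) - k * \<eta> t - 4 * k * \<xi> t) (at t)"
    and init: "\<omega> 0 = 1 / m" "\<eta> 0 = 0" "\<xi> 0 = 0"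
  shows "(\<integral>\<^sup>+ t \<in> {0..}. ennreal ((\<omega> t)\<^sup>2) \<partial>lborel)
      = ennreal ((d + 5 * m * k) / (2 * m * (2 * k * m + d)\<^sup>2))"
    and "(\<integral>\<^sup>+ t \<in> {0..}. ennreal ((4 * k * \<xi> t)\<^sup>2) \<partial>lborel) = ennreal (k / 2)"
proof -
  have p': "((\<lambda>t. m * \<omega> t + \<eta> t) has_real_derivative 4 * k * \<xi> t) (at t)" for t
    by (rule DERIV_cong[OF DERIV_add[OF DERIV_cmult[OF \<omega>'] \<eta>']]) (use pos in simp)
  have u': "((\<lambda>t. 4 * k * \<xi> t) has_real_derivative
      - 4 * k\<^sup>2 * (m * \<omega> t + \<eta> t) - 4 * k * (4 * k * \<xi> t)) (at t)" for t
    by (rule DERIV_cong[OF DERIV_cmult[OF \<xi>']]) (simp add: algebra_simps power2_eq_square)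
  show "(\<integral>\<^sup>+ t \<in> {0..}. ennreal ((\<omega> t)\<^sup>2) \<partial>lborel)
      = ennreal ((d + 5 * m * k) / (2 * m * (2 * k * m + d)\<^sup>2))"
    by (rule average_mode_integrals(1)[OF pos \<omega>' p' u']) (use init pos in simp_all)
  show "(\<integral>\<^sup>+ t \<in> {0..}. ennreal ((4 * k * \<xi> t)\<^sup>2) \<partial>lborel) = ennreal (k / 2)"
    by (rule average_mode_integrals(2)[OF pos \<omega>' p' u']) (use init pos in simp_all)
qed

text \<open>Here \<open>h\<close> is the gain \<open>k3\<close>. The bounds hold once
  \<open>q h\<close> is large and squeeze the two integrals with errors of order
  \<open>1 / q h\<close> and \<open>1 / (q h)\<^sup>2\<close>.\<close>

lemma controlled_mode_norms_tendsto:
  fixes \<theta> \<omega> \<eta> \<xi> :: "real \<Rightarrow> real \<Rightarrow> real"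
  assumes pos: "m > 0" "d > 0" "k > 0" "l > 0"
    and \<theta>': "\<And>h t. (\<theta> h has_real_derivative \<omega> h t) (at t)"
    and \<omega>': "\<And>h t. (\<omega> h has_real_derivative (- l * \<theta> h t - d * \<omega> h t + 4 * k * \<xi> h t) / m) (at t)"
    and \<eta>': "\<And>h t. (\<eta> h has_real_derivative d * \<omega> h t + 4 * k * h * (l * \<xi> h t)) (at t)"
    and \<xi>': "\<And>h t. (\<xi> h has_real_derivative - (k * m * \<omega> h t) - k * \<eta> h t - 4 * k * \<xi> h t) (at t)"
    and init: "\<And>h. \<theta> h 0 = 0" "\<And>h. \<omega> h 0 = 1 / m" "\<And>h. \<eta> h 0 = 0" "\<And>h. \<xi> h 0 = 0"
  shows "((\<lambda>h. \<integral>\<^sup>+ t \<in> {0..}. ennreal ((\<omega> h t)\<^sup>2) \<partial>lborel) \<longlongrightarrow> ennreal (1 / (2 * m * d))) at_top"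
    and "((\<lambda>h. \<integral>\<^sup>+ t \<in> {0..}. ennreal ((4 * k * \<xi> h t)\<^sup>2) \<partial>lborel) \<longlongrightarrow> 0) at_top"
proof -
  obtain e where e: "e > 0" "e * m \<le> d / 4" "e * d \<le> l / 8"
    using oscillator_cross_weight[OF pos(1,2,4)] .
  \<comment> \<open>Half the smallest diagonal dissipation rate. Like \<open>e\<close>, it is fixed
    before \<open>h\<close> and does not depend on it.\<close>
  define c where "c = min (min (d / 2) (e * l / 4)) (min (2 * k) (1 / (2 * k))) / 2"
  have c: "c > 0" "2 * c \<le> d / 2" "2 * c \<le> e * l / 4" "2 * c \<le> 2 * k" "2 * c \<le> 1 / (2 * k)"
    using pos e(1) by (auto simp: c_def)
  define M where "M = e + 2 + l / k + (1 + l / k\<^sup>2)"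
  define q where "q h = sqrt (1 + h * l)" for h
  have q_top: "filterlim q at_top at_top"
    unfolding q_def[abs_def]
    by (intro filterlim_compose[OF sqrt_at_top] filterlim_tendsto_add_at_top[OF tendsto_const]
        filterlim_at_top_mult_tendsto_pos[OF tendsto_const pos(4)] filterlim_ident)
  define K where "K = 1 / (2 * m) + 1 / (2::real)"
  have bounds:
    "(\<integral>\<^sup>+ t \<in> {0..}. ennreal ((\<omega> h t)\<^sup>2) \<partial>lborel) \<le> ennreal (1 / (2 * m * d) + 1 / (2 * c * d * q h) * K)"
    "ennreal (1 / (2 * m * d) - 1 / (2 * c * d * q h) * K) \<le> (\<integral>\<^sup>+ t \<in> {0..}. ennreal ((\<omega> h t)\<^sup>2) \<partial>lborel)"
    "(\<integral>\<^sup>+ t \<in> {0..}. ennreal ((4 * k * \<xi> h t)\<^sup>2) \<partial>lborel) \<le> ennreal ((2 + 2 * l\<^sup>2) / (c * (q h)\<^sup>2) * K)"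
    if h: "h > 0" and q2: "q h \<ge> 2" and qM: "M \<le> c * q h" for h
  proof -
    have qq: "(q h)\<^sup>2 = 1 + h * l" using h pos by (simp add: q_def add_nonneg_nonneg)
    have nz: "1 + h * l \<noteq> 0" using mult_pos_pos[OF h pos(4)] by simp
    define \<kappa> where "\<kappa> = l / (q h)\<^sup>2"
    have \<kappa>: "(1 + h * l) * \<kappa> = l" using nz by (simp add: \<kappa>_def qq)
    \<comment> \<open>With \<open>u = 4 k \<xi>\<close> and \<open>p = m \<omega> + \<eta>\<close> one has \<open>p' = - l \<theta> + q\<^sup>2 u\<close> and
      \<open>u' = - 4 k\<^sup>2 p - 4 k u\<close>. For frozen \<open>\<theta>\<close> the equilibrium is \<open>u = \<kappa> \<theta>\<close>, \<open>p = - \<kappa> \<theta> / k\<close>, and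
      \<open>a\<close>, \<open>b\<close> are the deviations from it.\<close>
    define p where "p t = m * \<omega> h t + \<eta> h t" for t
    define a where "a t = p t + \<kappa> / k * \<theta> h t" for t
    define b where "b t = 4 * k * \<xi> h t - \<kappa> * \<theta> h t" for t
    have p': "(p has_real_derivative - l * \<theta> h t + (1 + h * l) * (4 * k * \<xi> h t)) (at t)" for t
      unfolding p_def
      by (rule DERIV_cong[OF DERIV_add[OF DERIV_cmult[OF \<omega>'] \<eta>']])
        (use pos in \<open>simp; simp add: algebra_simps\<close>)
    have w: "(\<omega> h has_real_derivative (- (l - l / (q h)\<^sup>2) * \<theta> h t - d * \<omega> h t + b t) / m) (at t)" for t
      by (rule DERIV_cong[OF \<omega>']) (simp add: b_def \<kappa>_def algebra_simps)
    have a': "(a has_real_derivative (q h)\<^sup>2 * b t + l / (q h)\<^sup>2 / k * \<omega> h t) (at t)" for t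
    proof -
      have "- l * \<theta> h t + (1 + h * l) * (4 * k * \<xi> h t) + \<kappa> / k * \<omega> h t
          = (1 + h * l) * (4 * k * \<xi> h t) - ((1 + h * l) * \<kappa>) * \<theta> h t + \<kappa> / k * \<omega> h t"
        unfolding \<kappa> by simp
      also have "\<dots> = (q h)\<^sup>2 * b t + \<kappa> / k * \<omega> h t" unfolding qq b_def by (simp add: algebra_simps)
      finally show ?thesis
        unfolding a_def[abs_def] \<kappa>_def[symmetric] by (intro DERIV_cong[OF DERIV_add[OF p' DERIV_cmult[OF \<theta>']]])
    qed
    have b': "(b has_real_derivative - 4 * k\<^sup>2 * a t - 4 * k * b t - l / (q h)\<^sup>2 * \<omega> h t) (at t)" for t
      unfolding b_def[abs_def] \<kappa>_def[symmetric]
      by (rule DERIV_cong[OF DERIV_diff[OF DERIV_cmult[OF \<xi>'] DERIV_cmult[OF \<theta>']]])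
        (use pos in \<open>simp add: a_def p_def algebra_simps power2_eq_square\<close>)
    have i: "a 0 = 1" "b 0 = 0" using pos by (simp_all add: a_def b_def p_def init)
    note res = controlled_oscillator_integrals[OF pos e q2 c qM[unfolded M_def] \<theta>' w a' b' init(1,2) i]
    show "(\<integral>\<^sup>+ t \<in> {0..}. ennreal ((\<omega> h t)\<^sup>2) \<partial>lborel) \<le> ennreal (1 / (2 * m * d) + 1 / (2 * c * d * q h) * K)"
      "ennreal (1 / (2 * m * d) - 1 / (2 * c * d * q h) * K) \<le> (\<integral>\<^sup>+ t \<in> {0..}. ennreal ((\<omega> h t)\<^sup>2) \<partial>lborel)"
      using res(1,2) by (simp_all only: K_def)
    have "b t + l / (q h)\<^sup>2 * \<theta> h t = 4 * k * \<xi> h t" for t by (simp add: b_def \<kappa>_def)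
    with res(3) show "(\<integral>\<^sup>+ t \<in> {0..}. ennreal ((4 * k * \<xi> h t)\<^sup>2) \<partial>lborel)
        \<le> ennreal ((2 + 2 * l\<^sup>2) / (c * (q h)\<^sup>2) * K)" by (simp only: K_def)
  qed
  have "eventually (\<lambda>h. h > 0 \<and> q h \<ge> 2 \<and> M \<le> c * q h) at_top"
  proof -
    have "eventually (\<lambda>h. q h \<ge> max 2 (M / c)) at_top"
      using q_top unfolding filterlim_at_top by blast
    then show ?thesis
      using eventually_gt_at_top[of 0]
    proof eventually_elim
      case (elim h)
      then have "c * (M / c) \<le> c * q h" using c(1) by (intro mult_left_mono) auto
      then show ?case using elim c(1) by simp
    qed
  qed
  note ev = eventually_mono[OF this]
  have q_inv: "((\<lambda>h. 1 / q h) \<longlongrightarrow> 0) at_top"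
    using tendsto_inverse_0_at_top[OF q_top] by (simp add: inverse_eq_divide)
  have "((\<lambda>h. 1 / (2 * c * d) * (1 / q h) * K) \<longlongrightarrow> 1 / (2 * c * d) * 0 * K) at_top"
    by (intro tendsto_intros q_inv)
  then have small: "((\<lambda>h. 1 / (2 * c * d * q h) * K) \<longlongrightarrow> 0) at_top" by simp
  show "((\<lambda>h. \<integral>\<^sup>+ t \<in> {0..}. ennreal ((\<omega> h t)\<^sup>2) \<partial>lborel) \<longlongrightarrow> ennreal (1 / (2 * m * d))) at_top"
  proof (rule tendsto_sandwich)
    show "((\<lambda>h. ennreal (1 / (2 * m * d) - 1 / (2 * c * d * q h) * K)) \<longlongrightarrow> ennreal (1 / (2 * m * d))) at_top"
      using tendsto_diff[OF tendsto_const small, of "1 / (2 * m * d)"] by (intro tendsto_ennrealI) simp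
    show "((\<lambda>h. ennreal (1 / (2 * m * d) + 1 / (2 * c * d * q h) * K)) \<longlongrightarrow> ennreal (1 / (2 * m * d))) at_top"
      using tendsto_add[OF tendsto_const small, of "1 / (2 * m * d)"] by (intro tendsto_ennrealI) simp
  qed (rule ev, use bounds in blast)+
  have "((\<lambda>h. (2 + 2 * l\<^sup>2) / c * (1 / q h)\<^sup>2 * K) \<longlongrightarrow> (2 + 2 * l\<^sup>2) / c * 0\<^sup>2 * K) at_top"
    by (intro tendsto_intros q_inv)
  then have "((\<lambda>h. (2 + 2 * l\<^sup>2) / (c * (q h)\<^sup>2) * K) \<longlongrightarrow> 0) at_top" by (simp add: power_divide)
  from tendsto_ennrealI[OF this]
  have small_u: "((\<lambda>h. ennreal ((2 + 2 * l\<^sup>2) / (c * (q h)\<^sup>2) * K)) \<longlongrightarrow> 0) at_top" by simp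
  show "((\<lambda>h. \<integral>\<^sup>+ t \<in> {0..}. ennreal ((4 * k * \<xi> h t)\<^sup>2) \<partial>lborel) \<longlongrightarrow> 0) at_top"
    by (rule tendsto_sandwich[OF _ _ tendsto_const small_u]) (simp, rule ev, use bounds in blast)
qed

section \<open>Reduction of the closed loops to their modes\<close>

lemma block_stack4 [simp]:
  "block1 (stack4 p q r s) = p" "block2 (stack4 p q r s) = q"
  "block3 (stack4 p q r s) = r" "block4 (stack4 p q r s) = s"
  by (simp_all add: stack_defs vec_eq_iff)

lemma block_simps [simp]:
  "block1 0 = 0" "block2 0 = 0" "block3 0 = 0" "block4 0 = 0"
  "block1 (x + y) = block1 x + block1 y" "block2 (x + y) = block2 x + block2 y"
  "block3 (x + y) = block3 x + block3 y" "block4 (x + y) = block4 x + block4 y"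
  "block1 (a *\<^sub>R x) = a *\<^sub>R block1 x" "block2 (a *\<^sub>R x) = a *\<^sub>R block2 x"
  "block3 (a *\<^sub>R x) = a *\<^sub>R block3 x" "block4 (a *\<^sub>R x) = a *\<^sub>R block4 x"
  by (simp_all add: stack_defs vec_eq_iff)

lemma subspace_blocks:
  assumes "subspace S1" "subspace S2" "subspace S3" "subspace S4"
  shows "subspace {x. block1 x \<in> S1 \<and> block2 x \<in> S2 \<and> block3 x \<in> S3 \<and> block4 x \<in> S4}"
  using assms by (simp add: subspace_def)

lemma mat_exp_block_has_derivative:
  fixes A :: "real^('a::finite + 'b::finite + 'c::finite + 'd::finite)^('a + 'b + 'c + 'd)"
    and x :: "real^('a + 'b + 'c + 'd)"
  defines "X \<equiv> \<lambda>t. mat_exp (t *\<^sub>R A) *v x"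
  shows "((\<lambda>t. v1 \<bullet> block1 (X t)) has_real_derivative v1 \<bullet> block1 (A *v X t)) (at t)"
    "((\<lambda>t. v2 \<bullet> block2 (X t)) has_real_derivative v2 \<bullet> block2 (A *v X t)) (at t)"
    "((\<lambda>t. v3 \<bullet> block3 (X t)) has_real_derivative v3 \<bullet> block3 (A *v X t)) (at t)"
    "((\<lambda>t. v4 \<bullet> block4 (X t)) has_real_derivative v4 \<bullet> block4 (A *v X t)) (at t)"
  unfolding X_def inner_vec_def block1_def block2_def block3_def block4_def vec_lambda_beta inner_real_def
  by (auto intro!: DERIV_sum DERIV_cmult mat_exp_vector_has_derivative)

lemma span_singleton_unit:
  assumes "x \<in> span {v :: 'a::real_inner}" "norm v = 1"
  shows "x = (v \<bullet> x) *\<^sub>R v"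
  using assms by (auto simp: span_singleton norm_eq_1)

lemma dpiac_A_mult: "dpiac_A L m d k1 k3 *v x = dpiac_rhs L m d k1 k3 x 0"
  using dpiac_state_space[of L m d k1 k3 x 0] by simp

lemma dpiac_B_mult: "dpiac_B L m d k1 k3 *v w = stack4 0 ((1 / m) *\<^sub>R w) 0 0"
  using dpiac_state_space[of L m d k1 k3 0 w] by (simp add: dpiac_rhs_def Let_def)

lemma gbpiac_A_mult: "gbpiac_A L m d k1 *v x = gbpiac_rhs L m d k1 x 0"
  using gbpiac_state_space[of L m d k1 x 0] by simp

lemma gbpiac_B_mult: "gbpiac_B L m d k1 *v w = stack4 0 ((1 / m) *\<^sub>R w) 0 0"
proof -
  have "vec 0 = (0 :: real^1)" by (simp add: vec_eq_iff)
  then show ?thesis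
    using gbpiac_state_space[of L m d k1 0 w] by (simp add: gbpiac_rhs_def Let_def)
qed

text \<open>Symmetry moves \<open>L\<close> onto the eigenvector; this closes the equations of the
  coordinates along \<open>v\<close>.\<close>

lemma inner_eigenvector:
  fixes L :: "real^'n::finite^'n"
  assumes "transpose L = L" "L *v v = l *\<^sub>R v"
  shows "v \<bullet> (L *v y) = l * (v \<bullet> y)"
  by (metis assms dot_lmul_matrix inner_scaleR_left transpose_matrix_vector)

section \<open>Modes of DPIAC\<close>

text \<open>\<open>h\<close> stands for \<open>k3\<close> and \<open>l\<close> for the eigenvalue,
  whose sign is left open so that the kernel mode with \<open>l = 0\<close> is covered too.\<close>

locale dpiac_mode =
  fixes L :: "real^'n::finite^'n" and m d k h l :: real and v :: "real^'n"
  assumes sym: "transpose L = L" and ev: "L *v v = l *\<^sub>R v" and unit: "norm v = 1"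
    and m: "m > 0"
begin

definition X :: "real \<Rightarrow> real^('n + 'n + 'n + 'n)" where
  "X t = mat_exp (t *\<^sub>R dpiac_A L m d k h) *v (dpiac_B L m d k h *v v)"

lemma mode_ode:
  "((\<lambda>t. v \<bullet> block1 (X t)) has_real_derivative v \<bullet> block2 (X t)) (at t)"
  "((\<lambda>t. v \<bullet> block2 (X t)) has_real_derivative
      (- l * (v \<bullet> block1 (X t)) - d * (v \<bullet> block2 (X t)) + 4 * k * (v \<bullet> block4 (X t))) / m) (at t)"
  "((\<lambda>t. v \<bullet> block3 (X t)) has_real_derivative
      d * (v \<bullet> block2 (X t)) + 4 * k * h * (l * (v \<bullet> block4 (X t)))) (at t)"
  "((\<lambda>t. v \<bullet> block4 (X t)) has_real_derivative
      - (k * m * (v \<bullet> block2 (X t))) - k * (v \<bullet> block3 (X t)) - 4 * k * (v \<bullet> block4 (X t))) (at t)"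
  unfolding X_def
  by (rule DERIV_cong[OF mat_exp_block_has_derivative(1)] DERIV_cong[OF mat_exp_block_has_derivative(2)]
        DERIV_cong[OF mat_exp_block_has_derivative(3)] DERIV_cong[OF mat_exp_block_has_derivative(4)],
      simp add: dpiac_A_mult dpiac_rhs_def Let_def inner_add_right inner_diff_right
        inner_eigenvector[OF sym ev])+

lemma mode_init:
  "v \<bullet> block1 (X 0) = 0" "v \<bullet> block2 (X 0) = 1 / m" "v \<bullet> block3 (X 0) = 0" "v \<bullet> block4 (X 0) = 0"
  using unit mat_exp_0[of "dpiac_A L m d k h"] by (simp_all add: X_def dpiac_B_mult norm_eq_1)

text \<open>The coordinates along \<open>v\<close> give the full output norm because the subspace of
  states with all four blocks in \<open>span {v}\<close> is invariant and contains the initial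
  state.\<close>

lemma mode_output:
  "(norm (matrix dpiac_omega *v X t))\<^sup>2 = (v \<bullet> block2 (X t))\<^sup>2"
  "(norm (matrix (dpiac_u k) *v X t))\<^sup>2 = (4 * k * (v \<bullet> block4 (X t)))\<^sup>2"
proof -
  define S where "S = {x :: real^('n + 'n + 'n + 'n). block1 x \<in> span {v} \<and> block2 x \<in> span {v}
      \<and> block3 x \<in> span {v} \<and> block4 x \<in> span {v}}"
  have L: "L *v x \<in> span {v}" if x: "x \<in> span {v}" for x
  proof -
    have "L *v x = (v \<bullet> x) *\<^sub>R l *\<^sub>R v"
      by (subst span_singleton_unit[OF x unit]) (simp add: matrix_vector_mult_scaleR ev)
    then show ?thesis by (simp add: span_base span_scale)
  qed
  have "X t \<in> S"
    unfolding X_def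
  proof (rule mat_exp_in_invariant_subspace)
    show "subspace S" unfolding S_def by (intro subspace_blocks subspace_span)
    show "dpiac_A L m d k h *v x \<in> S" if "x \<in> S" for x
      using that unfolding S_def dpiac_A_mult
      by (auto simp: dpiac_rhs_def Let_def intro!: span_add span_diff span_neg span_scale L)
    show "dpiac_B L m d k h *v v \<in> S"
      by (simp add: S_def dpiac_B_mult span_zero span_scale span_base)
  qed
  then have "block2 (X t) = (v \<bullet> block2 (X t)) *\<^sub>R v" "block4 (X t) = (v \<bullet> block4 (X t)) *\<^sub>R v"
    using span_singleton_unit[OF _ unit] by (auto simp: S_def)
  from arg_cong[OF this(1), of norm] arg_cong[OF this(2), of norm]
  show "(norm (matrix dpiac_omega *v X t))\<^sup>2 = (v \<bullet> block2 (X t))\<^sup>2"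
    "(norm (matrix (dpiac_u k) *v X t))\<^sup>2 = (4 * k * (v \<bullet> block4 (X t)))\<^sup>2"
    by (simp_all add: output_matrices dpiac_omega_def dpiac_u_def unit power_mult_distrib)
qed

end

lemma dpiac_average_mode:
  fixes L :: "real^'n::finite^'n"
  assumes "transpose L = L" "L *v v = 0" "norm v = 1" and pos: "m > 0" "d > 0" "k > 0"
  shows "(\<integral>\<^sup>+ t \<in> {0..}. ennreal ((norm (matrix dpiac_omega *v
      (mat_exp (t *\<^sub>R dpiac_A L m d k h) *v (dpiac_B L m d k h *v v))))\<^sup>2) \<partial>lborel)
      = ennreal ((d + 5 * m * k) / (2 * m * (2 * k * m + d)\<^sup>2))" (is ?omega)
    and "(\<integral>\<^sup>+ t \<in> {0..}. ennreal ((norm (matrix (dpiac_u k) *v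
      (mat_exp (t *\<^sub>R dpiac_A L m d k h) *v (dpiac_B L m d k h *v v))))\<^sup>2) \<partial>lborel) = ennreal (k / 2)" (is ?u)
proof -
  interpret dpiac_mode L m d k h 0 v by unfold_locales (use assms in auto)
  note res = average_mode_norms[OF pos _ _ mode_ode(4) mode_init(2-4)]
  show ?omega ?u
    unfolding X_def[symmetric] mode_output
    by (rule res; use mode_ode(2,3) in simp)+
qed

lemma dpiac_oscillating_mode:
  fixes L :: "real^'n::finite^'n"
  assumes "transpose L = L" "L *v v = l *\<^sub>R v" "norm v = 1" and pos: "m > 0" "d > 0" "k > 0" "l > 0"
  shows "((\<lambda>h. \<integral>\<^sup>+ t \<in> {0..}. ennreal ((norm (matrix dpiac_omega *v
      (mat_exp (t *\<^sub>R dpiac_A L m d k h) *v (dpiac_B L m d k h *v v))))\<^sup>2) \<partial>lborel)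
      \<longlongrightarrow> ennreal (1 / (2 * m * d))) at_top" (is ?omega)
    and "((\<lambda>h. \<integral>\<^sup>+ t \<in> {0..}. ennreal ((norm (matrix (dpiac_u k) *v
      (mat_exp (t *\<^sub>R dpiac_A L m d k h) *v (dpiac_B L m d k h *v v))))\<^sup>2) \<partial>lborel) \<longlongrightarrow> 0) at_top" (is ?u)
proof -
  \<comment> \<open>The locale assumptions do not mention \<open>d\<close>, \<open>k\<close> and
    \<open>h\<close>. One instance thus gives the modal equations for all \<open>h\<close> at once,
    as the limit requires.\<close>
  have mode: "dpiac_mode L m l v" by unfold_locales (use assms in auto)
  note X = dpiac_mode.X_def[OF mode, symmetric]
  note ode = dpiac_mode.mode_ode[OF mode] and init = dpiac_mode.mode_init[OF mode]
  note res = controlled_mode_norms_tendsto[OF pos ode init]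
  show ?omega ?u
    unfolding X dpiac_mode.mode_output[OF mode] by (rule res)+
qed

section \<open>Modes of GBPIAC\<close>

locale gbpiac_mode =
  fixes L :: "real^'n::finite^'n" and m d k l :: real and v :: "real^'n"
  assumes sym: "transpose L = L" and ev: "L *v v = l *\<^sub>R v" and unit: "norm v = 1"
    and m: "m > 0"
begin

definition X :: "real \<Rightarrow> real^('n + 'n + 1 + 1)" where
  "X t = mat_exp (t *\<^sub>R gbpiac_A L m d k) *v (gbpiac_B L m d k *v v)"

lemma mode_ode:
  "((\<lambda>t. v \<bullet> block1 (X t)) has_real_derivative v \<bullet> block2 (X t)) (at t)"
  "((\<lambda>t. v \<bullet> block2 (X t)) has_real_derivative
      (- l * (v \<bullet> block1 (X t)) - d * (v \<bullet> block2 (X t))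
        + 4 * k * (block4 (X t) $ 1) / real CARD('n) * (v \<bullet> vec 1)) / m) (at t)"
  "((\<lambda>t. block3 (X t) $ 1) has_real_derivative d * (vec 1 \<bullet> block2 (X t))) (at t)"
  "((\<lambda>t. block4 (X t) $ 1) has_real_derivative
      - (k * m * (vec 1 \<bullet> block2 (X t))) - k * (block3 (X t) $ 1) - 4 * k * (block4 (X t) $ 1)) (at t)"
proof -
  note D = mat_exp_block_has_derivative[of _ "gbpiac_A L m d k" "gbpiac_B L m d k *v v", folded X_def]
  show "((\<lambda>t. v \<bullet> block1 (X t)) has_real_derivative v \<bullet> block2 (X t)) (at t)"
    using D(1)[of v t] by (simp add: gbpiac_A_mult gbpiac_rhs_def Let_def)
  show "((\<lambda>t. v \<bullet> block2 (X t)) has_real_derivative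
      (- l * (v \<bullet> block1 (X t)) - d * (v \<bullet> block2 (X t))
        + 4 * k * (block4 (X t) $ 1) / real CARD('n) * (v \<bullet> vec 1)) / m) (at t)"
    by (rule DERIV_cong[OF D(2)])
      (simp add: gbpiac_A_mult gbpiac_rhs_def Let_def inner_add_right inner_diff_right inner_eigenvector[OF sym ev])
  show "((\<lambda>t. block3 (X t) $ 1) has_real_derivative d * (vec 1 \<bullet> block2 (X t))) (at t)"
    using D(3)[of "1" t] by (simp add: gbpiac_A_mult gbpiac_rhs_def Let_def inner_vec_def)
  show "((\<lambda>t. block4 (X t) $ 1) has_real_derivative
      - (k * m * (vec 1 \<bullet> block2 (X t))) - k * (block3 (X t) $ 1) - 4 * k * (block4 (X t) $ 1)) (at t)"
    using D(4)[of "1" t] by (simp add: gbpiac_A_mult gbpiac_rhs_def Let_def inner_vec_def)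
qed

lemma mode_init:
  "v \<bullet> block1 (X 0) = 0" "v \<bullet> block2 (X 0) = 1 / m" "block3 (X 0) $ 1 = 0" "block4 (X 0) $ 1 = 0"
  using unit mat_exp_0[of "gbpiac_A L m d k"] by (simp_all add: X_def gbpiac_B_mult norm_eq_1)

text \<open>\<open>T\<close> is the space in which the two scalar controller states move:
  \<open>{0}\<close> for \<open>v\<close> orthogonal to the constants, everything for constant
  \<open>v\<close>. The two conditions say that the measurement of a mode lands in \<open>T\<close>
  and that the resulting input stays on the line through \<open>v\<close>.\<close>

lemma mode_block_in:
  assumes T: "subspace T" and inv: "\<And>x. x \<in> span {v} \<Longrightarrow> vec (vec 1 \<bullet> x) \<in> T"
    and force: "\<And>y. y \<in> T \<Longrightarrow> (y $ 1) *\<^sub>R vec 1 \<in> span {v}"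
  shows "block2 (X t) \<in> span {v}" "block4 (X t) \<in> T"
proof -
  define S where "S = {x :: real^('n + 'n + 1 + 1). block1 x \<in> span {v} \<and> block2 x \<in> span {v}
      \<and> block3 x \<in> T \<and> block4 x \<in> T}"
  have L: "L *v x \<in> span {v}" if x: "x \<in> span {v}" for x
  proof -
    have "L *v x = (v \<bullet> x) *\<^sub>R l *\<^sub>R v"
      by (subst span_singleton_unit[OF x unit]) (simp add: matrix_vector_mult_scaleR ev)
    then show ?thesis by (simp add: span_base span_scale)
  qed
  have "X t \<in> S"
    unfolding X_def
  proof (rule mat_exp_in_invariant_subspace)
    show "subspace S" unfolding S_def by (intro subspace_blocks subspace_span T)
    show "gbpiac_A L m d k *v x \<in> S" if "x \<in> S" for x
    proof -
      have x: "block1 x \<in> span {v}" "block2 x \<in> span {v}" "block3 x \<in> T" "block4 x \<in> T"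
        using that by (auto simp: S_def)
      have "(4 * k * (block4 x $ 1) / real CARD('n)) *\<^sub>R vec 1
          = (4 * k / real CARD('n)) *\<^sub>R (block4 x $ 1) *\<^sub>R (vec 1 :: real^'n)" by simp
      also have "\<dots> \<in> span {v}" by (intro span_scale force x)
      finally have u: "(4 * k * (block4 x $ 1) / real CARD('n)) *\<^sub>R vec 1 \<in> span {v}" .
      have "vec (d * (vec 1 \<bullet> block2 x)) = d *\<^sub>R (vec (vec 1 \<bullet> block2 x) :: real^1)"
        by (simp add: vec_eq_iff)
      also have "\<dots> \<in> T" by (intro subspace_scale T inv x)
      finally have e: "vec (d * (vec 1 \<bullet> block2 x)) \<in> T" .
      have "vec (- (k * m * (vec 1 \<bullet> block2 x)) - k * (block3 x $ 1) - 4 * k * (block4 x $ 1))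
          = - (k * m) *\<^sub>R (vec (vec 1 \<bullet> block2 x) :: real^1) - k *\<^sub>R block3 x - (4 * k) *\<^sub>R block4 x"
        by (simp add: vec_eq_iff num1_eq_iff)
      also have "\<dots> \<in> T" by (intro subspace_diff subspace_scale subspace_neg T inv x)
      finally have f: "vec (- (k * m * (vec 1 \<bullet> block2 x)) - k * (block3 x $ 1) - 4 * k * (block4 x $ 1)) \<in> T" .
      show ?thesis
        unfolding S_def gbpiac_A_mult gbpiac_rhs_def Let_def
        by (simp only: mem_Collect_eq block_stack4 add_0_right)
          (intro conjI e f x span_scale span_add span_diff span_neg L u)
    qed
    show "gbpiac_B L m d k *v v \<in> S"
      by (simp add: S_def gbpiac_B_mult span_zero span_scale span_base subspace_0[OF T])
  qed
  then show "block2 (X t) \<in> span {v}" "block4 (X t) \<in> T" by (auto simp: S_def)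
qed

end

text \<open>The controller sees only \<open>vec 1 \<bullet> \<omega>\<close>, which vanishes on this
  mode. It stays at rest and leaves the uncontrolled oscillator.\<close>

lemma gbpiac_oscillating_mode:
  fixes L :: "real^'n::finite^'n"
  assumes "transpose L = L" "L *v v = l *\<^sub>R v" "norm v = 1" and orth: "vec 1 \<bullet> v = 0"
    and pos: "m > 0" "d > 0" "l > 0"
  shows "(\<integral>\<^sup>+ t \<in> {0..}. ennreal ((norm (matrix gbpiac_omega *v
      (mat_exp (t *\<^sub>R gbpiac_A L m d k) *v (gbpiac_B L m d k *v v))))\<^sup>2) \<partial>lborel)
      = ennreal (1 / (2 * m * d))" (is ?omega)
    and "(\<integral>\<^sup>+ t \<in> {0..}. ennreal ((norm (matrix (gbpiac_u k) *v
      (mat_exp (t *\<^sub>R gbpiac_A L m d k) *v (gbpiac_B L m d k *v v))))\<^sup>2) \<partial>lborel) = 0" (is ?u)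
proof -
  interpret gbpiac_mode L m d k l v by unfold_locales (use assms in auto)
  have "\<And>x. x \<in> span {v} \<Longrightarrow> vec (vec 1 \<bullet> x) \<in> {0 :: real^1}"
    and "\<And>y :: real^1. y \<in> {0} \<Longrightarrow> (y $ 1) *\<^sub>R vec 1 \<in> span {v}"
    using orth by (auto simp: span_singleton vec_eq_iff)
  note * = mode_block_in[OF subspace_single_0 this]
  have "(norm (matrix gbpiac_omega *v X t))\<^sup>2 = (v \<bullet> block2 (X t))\<^sup>2" for t
    using arg_cong[OF span_singleton_unit[OF *(1) unit], of norm]
    by (simp add: output_matrices gbpiac_omega_def unit)
  moreover have "(\<integral>\<^sup>+ t \<in> {0..}. ennreal ((v \<bullet> block2 (X t))\<^sup>2) \<partial>lborel) = ennreal (1 / (2 * m * d))"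
    by (rule damped_oscillator_integral[OF pos mode_ode(1) _ mode_init(1,2)])
      (use mode_ode(2) orth in \<open>simp add: inner_commute\<close>)
  ultimately show ?omega unfolding X_def[symmetric] by simp
  have "matrix (gbpiac_u k) *v X t = 0" for t
    using *(2) by (simp add: output_matrices gbpiac_u_def)
  then show ?u unfolding X_def[symmetric] by simp
qed

text \<open>As \<open>vec 1\<close> is \<open>r *\<^sub>R v\<close> with \<open>r\<^sup>2\<close>
  the number of nodes, dividing both scalar controller states by \<open>r\<close> turns the
  equations into those of the DPIAC kernel mode.\<close>

lemma gbpiac_average_mode:
  fixes L :: "real^'n::finite^'n"
  assumes "transpose L = L" "L *v vec 1 = 0" and pos: "m > 0" "d > 0" "k > 0"
  defines "v \<equiv> (1 / sqrt (real CARD('n))) *\<^sub>R vec 1"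
  shows "(\<integral>\<^sup>+ t \<in> {0..}. ennreal ((norm (matrix gbpiac_omega *v
      (mat_exp (t *\<^sub>R gbpiac_A L m d k) *v (gbpiac_B L m d k *v v))))\<^sup>2) \<partial>lborel)
      = ennreal ((d + 5 * m * k) / (2 * m * (2 * k * m + d)\<^sup>2))" (is ?omega)
    and "(\<integral>\<^sup>+ t \<in> {0..}. ennreal ((norm (matrix (gbpiac_u k) *v
      (mat_exp (t *\<^sub>R gbpiac_A L m d k) *v (gbpiac_B L m d k *v v))))\<^sup>2) \<partial>lborel) = ennreal (k / 2)" (is ?u)
proof -
  define r where "r = sqrt (real CARD('n))"
  have r: "r > 0" "r\<^sup>2 = real CARD('n)" by (simp_all add: r_def)
  have one: "vec 1 \<bullet> (vec 1 :: real^'n) = r\<^sup>2" unfolding r by (simp add: inner_vec_def)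
  have v: "vec 1 = r *\<^sub>R v" unfolding v_def r_def[symmetric] using r(1) by simp
  have unit: "norm v = 1"
    unfolding norm_eq_1 v_def r_def[symmetric] using r(1) one by (simp add: power2_eq_square)
  have Lv: "L *v v = 0 *\<^sub>R v" unfolding v_def matrix_vector_mult_scaleR assms(2) by simp
  interpret gbpiac_mode L m d k 0 v by unfold_locales (use assms(1) Lv unit pos in auto)
  have vv: "v \<bullet> v = 1" using unit by (simp add: norm_eq_1)
  have *: "block2 (X t) \<in> span {v}" for t
  proof (rule mode_block_in[of UNIV])
    show "(y $ 1) *\<^sub>R vec 1 \<in> span {v}" for y :: "real^1"
      unfolding v by (intro span_scale span_base) auto
  qed auto
  have omega: "(norm (matrix gbpiac_omega *v X t))\<^sup>2 = (v \<bullet> block2 (X t))\<^sup>2" for t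
    using arg_cong[OF span_singleton_unit[OF * unit], of norm]
    by (simp add: output_matrices gbpiac_omega_def unit)
  have u: "(norm (matrix (gbpiac_u k) *v X t))\<^sup>2 = (4 * k * (block4 (X t) $ 1 / r))\<^sup>2" for t
  proof -
    have "matrix (gbpiac_u k) *v X t = (4 * k * (block4 (X t) $ 1 / r)) *\<^sub>R v"
      unfolding output_matrices gbpiac_u_def v r(2)[symmetric] using r(1)
      by (simp add: power2_eq_square)
    then show ?thesis by (simp only: norm_scaleR unit mult_1_right power2_abs)
  qed
  have w: "((\<lambda>t. v \<bullet> block2 (X t)) has_real_derivative
      (- d * (v \<bullet> block2 (X t)) + 4 * k * (block4 (X t) $ 1 / r)) / m) (at t)" for t
    by (rule DERIV_cong[OF mode_ode(2)], unfold v r(2)[symmetric]) (use r(1) in \<open>simp add: vv power2_eq_square\<close>)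
  have e: "((\<lambda>t. block3 (X t) $ 1 / r) has_real_derivative d * (v \<bullet> block2 (X t))) (at t)" for t
    by (rule DERIV_cong[OF DERIV_cdivide[OF mode_ode(3)]], unfold v) (use r(1) in simp)
  have x: "((\<lambda>t. block4 (X t) $ 1 / r) has_real_derivative - (k * m * (v \<bullet> block2 (X t)))
      - k * (block3 (X t) $ 1 / r) - 4 * k * (block4 (X t) $ 1 / r)) (at t)" for t
    by (rule DERIV_cong[OF DERIV_cdivide[OF mode_ode(4)]], unfold v)
      (use r(1) in \<open>simp add: diff_divide_distrib\<close>)
  note res = average_mode_norms[OF pos w e x]
  show ?omega ?u
    unfolding X_def[symmetric] omega u by (rule res; use mode_init in simp)+
qed

section \<open>Summation over the modes\<close>

theorem mainTheorem5:
  fixes E :: "('n::finite \<times> 'n) set"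
    and c :: "'n \<Rightarrow> 'n \<Rightarrow> real"
    and L :: "real^'n^'n"
    and m d k1 :: real
  assumes "m > 0" and "d > 0" and "k1 > 0"
    and "connected_weighted_graph E c"
    and "L = laplacian E c"
  shows "((\<lambda>k3. dpiac_h2_omega L m d k1 k3) \<longlongrightarrow>
            ennreal ((real CARD('n) - 1) / (2 * m * d)
                     + (d + 5 * m * k1) / (2 * m * (2 * k1 * m + d)\<^sup>2))) at_top
       \<and> ennreal ((real CARD('n) - 1) / (2 * m * d)
                     + (d + 5 * m * k1) / (2 * m * (2 * k1 * m + d)\<^sup>2))
           = gbpiac_h2_omega L m d k1
       \<and> ((\<lambda>k3. dpiac_h2_u L m d k1 k3) \<longlongrightarrow> ennreal (k1 / 2)) at_top
       \<and> ennreal (k1 / 2) = gbpiac_h2_u L m d k1"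
proof -
  note pos = assms(1-3) and G = assms(4)
  let ?e = "(1 / sqrt (real CARD('n))) *\<^sub>R (vec 1 :: real^'n)"
  let ?avg = "(d + 5 * m * k1) / (2 * m * (2 * k1 * m + d)\<^sup>2)"
  obtain B :: "(real^'n) set" where B: "\<And>v. v \<in> B \<Longrightarrow> norm v = 1" "finite B" "card B = CARD('n) - 1"
      "\<And>v. v \<in> B \<Longrightarrow> vec 1 \<bullet> v = 0" "\<And>v. v \<in> B \<Longrightarrow> \<exists>\<mu> > 0. L *v v = \<mu> *\<^sub>R v"
      "pairwise orthogonal (insert ?e B)" "span (insert ?e B) = UNIV"
    using laplacian_orthonormal_eigenbasis[OF G] unfolding assms(5) by metis
  obtain l where l: "\<And>v. v \<in> B \<Longrightarrow> l v > 0" "\<And>v. v \<in> B \<Longrightarrow> L *v v = l v *\<^sub>R v"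
    using B(5) by metis
  have sym: "transpose L = L" and ones: "L *v vec 1 = 0"
    unfolding assms(5) by (rule transpose_laplacian[OF G], rule laplacian_ones[OF G])
  have one: "vec 1 \<bullet> (vec 1 :: real^'n) = real CARD('n)" by (simp add: inner_vec_def)
  have unit: "norm ?e = 1" unfolding norm_eq_1 using one by simp
  have Le: "L *v ?e = 0" by (simp only: matrix_vector_mult_scaleR ones scaleR_zero_right)
  \<comment> \<open>Needed to split the sum over \<open>insert ?e B\<close> without losing a
    term.\<close>
  have "?e \<notin> B" using B(4)[of ?e] one by auto
  then have split: "h2_norm_sq A b C =
      (\<integral>\<^sup>+ t \<in> {0..}. ennreal ((norm (C *v (mat_exp (t *\<^sub>R A) *v (b *v ?e))))\<^sup>2) \<partial>lborel)
      + (\<Sum>v\<in>B. \<integral>\<^sup>+ t \<in> {0..}. ennreal ((norm (C *v (mat_exp (t *\<^sub>R A) *v (b *v v))))\<^sup>2) \<partial>lborel)"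
    for A :: "real^'s::finite^'s" and b :: "real^'n^'s" and C :: "real^'s^'o::finite"
    using B(1,2) unit by (subst h2_norm_sq_orthonormal_basis[OF B(6) _ B(7)]) auto
  have total: "ennreal ?avg + (\<Sum>v\<in>B. ennreal (1 / (2 * m * d)))
      = ennreal ((real CARD('n) - 1) / (2 * m * d) + ?avg)"
  proof -
    have "(\<Sum>v\<in>B. ennreal (1 / (2 * m * d))) = ennreal (\<Sum>v\<in>B. 1 / (2 * m * d))"
      using pos by (intro sum_ennreal) auto
    \<comment> \<open>\<open>card B\<close> is a truncated difference; it agrees with the real one
      since there is at least one node.\<close>
    also have "(\<Sum>v\<in>B. 1 / (2 * m * d)) = (real CARD('n) - 1) / (2 * m * d)"
      using B(3) by (simp add: of_nat_diff)
    finally show ?thesis using pos by (simp add: ennreal_plus[symmetric] add.commute del: ennreal_plus)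
  qed
  note dpiac = dpiac_oscillating_mode[OF sym l(2) B(1) pos l(1)]
    and gbpiac = gbpiac_oscillating_mode[OF sym l(2) B(1,4) pos(1,2) l(1)]
  have "((\<lambda>k3. dpiac_h2_omega L m d k1 k3) \<longlongrightarrow> ennreal ?avg + (\<Sum>v\<in>B. ennreal (1 / (2 * m * d)))) at_top"
    unfolding dpiac_h2_omega_def split dpiac_average_mode(1)[OF sym Le unit pos]
    by (intro tendsto_add tendsto_const tendsto_sum dpiac(1))
  moreover have "gbpiac_h2_omega L m d k1 = ennreal ?avg + (\<Sum>v\<in>B. ennreal (1 / (2 * m * d)))"
    unfolding gbpiac_h2_omega_def split gbpiac_average_mode(1)[OF sym ones pos]
    by (rule arg_cong2[OF refl sum.cong[OF refl gbpiac(1)]])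
  moreover have "((\<lambda>k3. dpiac_h2_u L m d k1 k3) \<longlongrightarrow> ennreal (k1 / 2) + (\<Sum>v\<in>B. 0)) at_top"
    unfolding dpiac_h2_u_def split dpiac_average_mode(2)[OF sym Le unit pos]
    by (intro tendsto_add tendsto_const tendsto_sum dpiac(2))
  moreover have "gbpiac_h2_u L m d k1 = ennreal (k1 / 2) + (\<Sum>v\<in>B. 0)"
    unfolding gbpiac_h2_u_def split gbpiac_average_mode(2)[OF sym ones pos]
    by (rule arg_cong2[OF refl sum.cong[OF refl gbpiac(2)]])
  ultimately show ?thesis by (simp only: total sum.neutral_const add_0_right simp_thms)
qed

end
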